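(* Let $G=(Y\cup Z,E)$ be a distance-biregular graph with intersection array \[ \begin{vmatrix} k; & c_1^{Y}, & c_2^{Y}, & c_3^{Y}, & c_4^{Y} \\ \ell; & c_1^{Z}, & c_2^{Z}, & c_3^{Z}, & c_4^{Z}\end{vmatrix} \] (so all vertices have eccentricity $4$). Put $b_2^Z=\ell-c_2^Z$ and $b_3^Z=k-c_3^Z$. Suppose that \[ (b_2^{Z}-1)(c_4^{Z}-1)-\frac{b_3^{Z}(c_4^{Z}-1)+c_3^{Z}(b_2^{Z}-1)}{c_2^{Y}}\,(c_2^{Z}-1)=0, \] and let \[ \gamma_3=\frac{c_2^{Y}c_3^{Z}(b_2^{Z}-1)}{b_3^{Z}(c_4^{Z}-1)+c_3^{Z}(b_2^{Z}-1)}. \] If $c_2^Y>\gamma_3$ and $b_3^Z>c_2^Y-\gamma_3$, then for every $z\in Z$ the subgraph of $G$ induced by $N_3(z)\cup N_4(z)$ is distance-biregular with intersection array \[ \begin{vmatrix} b_3^{Z}; & 1, & c_2^{Y}-\gamma_3, & c_3^{Y}, & b_3^{Z} \\ \ell; & 1, & c_2^{Z}, & \frac{(c_2^{Y}-\gamma_3)c_3^{Y}}{c_2^{Z}}, & \ell\end{vmatrix}, \] where the first row refers to the vertices in $N_3(z)\subseteq Y$ and the second to the vertices in $N_4(z)\subseteq Z$.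
   Context: $N_i(a)$ denotes the set of vertices at distance $i$ from $a$. A bipartite graph with bipartition $Y\cup Z$ is distance-biregular if for every vertex $a$, every $i$, and every vertex $w$ at distance $i$ from $a$, the numbers $c_i(a)=|\{u\sim w: d(a,u)=i-1\}|$ and $b_i(a)=|\{u\sim w: d(a,u)=i+1\}|$ depend only on $i$ and on which part contains $a$; these are denoted $c_i^Y,b_i^Y$ or $c_i^Z,b_i^Z$. The intersection array $\begin{vmatrix} k; & c_1^{Y}, & \dots, & c_{d_Y}^{Y} \\ \ell; & c_1^{Z}, & \dots, & c_{d_Z}^{Z}\end{vmatrix}$ records the valency $k$ of vertices in $Y$, the valency $\ell$ of vertices in $Z$, and the $c_i$ values up to the eccentricities $d_Y,d_Z$ of vertices in $Y,Z$. *)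

theory Defs
  imports "Graph_Theory.Graph_Theory"
begin

text \<open>
  A finite simple undirected graph is an element of the locale \<^locale>\<open>graph\<close>: every edge is
  represented by its two opposite arcs, so \<^const>\<open>out_degree\<close> is the valency.
\<close>

definition gdist :: "('a, 'b) pre_digraph \<Rightarrow> 'a \<Rightarrow> 'a \<Rightarrow> ereal" where
  "gdist G u v = wf_digraph.\<mu> G (\<lambda>_. 1) u v"

definition nbhd :: "('a, 'b) pre_digraph \<Rightarrow> nat \<Rightarrow> 'a \<Rightarrow> 'a set" where
  "nbhd G i a = {w \<in> verts G. gdist G a w = ereal (real i)}"

definition eccentricity :: "('a, 'b) pre_digraph \<Rightarrow> 'a \<Rightarrow> ereal" where
  "eccentricity G a = (SUP w\<in>verts G. gdist G a w)"

text \<open>The counts below are meant for \<open>w \<in> nbhd G i a\<close>; the difference is taken in the reals, so that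
  the first one is \<open>0\<close> for \<open>i = 0\<close>.\<close>

definition c_count :: "('a, 'b) pre_digraph \<Rightarrow> nat \<Rightarrow> 'a \<Rightarrow> 'a \<Rightarrow> nat" where
  "c_count G i a w =
     card {u \<in> verts G. w \<rightarrow>\<^bsub>G\<^esub> u \<and> gdist G a u = ereal (real i - 1)}"

definition b_count :: "('a, 'b) pre_digraph \<Rightarrow> nat \<Rightarrow> 'a \<Rightarrow> 'a \<Rightarrow> nat" where
  "b_count G i a w =
     card {u \<in> verts G. w \<rightarrow>\<^bsub>G\<^esub> u \<and> gdist G a u = ereal (real i + 1)}"

definition bipartite_graph :: "('a, 'b) pre_digraph \<Rightarrow> 'a set \<Rightarrow> 'a set \<Rightarrow> bool" where
  "bipartite_graph G Y Z \<longleftrightarrow>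
     graph G \<and> verts G = Y \<union> Z \<and> Y \<inter> Z = {} \<and>
     (\<forall>u v. u \<rightarrow>\<^bsub>G\<^esub> v \<longrightarrow> u \<in> Y \<and> v \<in> Z \<or> u \<in> Z \<and> v \<in> Y)"

text \<open>Connectedness is not demanded here; it follows from the finite eccentricities in
  \<open>intersection_array\<close>, since \<^const>\<open>gdist\<close> is \<open>\<infinity>\<close> between different components.\<close>

definition distance_biregular :: "('a, 'b) pre_digraph \<Rightarrow> 'a set \<Rightarrow> 'a set \<Rightarrow> bool" where
  "distance_biregular G Y Z \<longleftrightarrow>
     bipartite_graph G Y Z \<and>
     (\<forall>P\<in>{Y, Z}. \<forall>i. \<exists>c b. \<forall>a\<in>P. \<forall>w\<in>nbhd G i a. c_count G i a w = c \<and> b_count G i a w = b)"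

text \<open>A row \<open>(k, [c\<^sub>1, \<dots>, c\<^sub>d])\<close> of an intersection array, for the vertices of one part \<open>P\<close>. The entries are
  reals so that arrays whose entries are given by rational expressions can be written down.\<close>

definition array_row :: "('a, 'b) pre_digraph \<Rightarrow> 'a set \<Rightarrow> real \<times> real list \<Rightarrow> bool" where
  "array_row G P = (\<lambda>(k, cs). \<forall>a\<in>P.
     real (out_degree G a) = k \<and>
     eccentricity G a = ereal (real (length cs)) \<and>
     (\<forall>i\<in>{1..length cs}. \<forall>w\<in>nbhd G i a. real (c_count G i a w) = cs ! (i - 1)))"

definition intersection_array ::
    "('a, 'b) pre_digraph \<Rightarrow> 'a set \<Rightarrow> 'a set \<Rightarrow> real \<times> real list \<Rightarrow> real \<times> real list \<Rightarrow> bool" where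
  "intersection_array G Y Z rowY rowZ \<longleftrightarrow> array_row G Y rowY \<and> array_row G Z rowZ"

end

theory Submission
  imports Defs
begin

text \<open>
  Fix \<open>z \<in> Z\<close> and \<open>x \<in> N\<^sub>3(z)\<close>. For \<open>y \<in> N\<^sub>3(z)\<close> at distance \<open>2\<close> from \<open>x\<close>, let \<open>g(y)\<close> and \<open>h(y)\<close> be the numbers of
  common neighbours of \<open>x\<close> and \<open>y\<close> in \<open>N\<^sub>2(z)\<close> and in \<open>N\<^sub>4(z)\<close>; their sum is \<open>c\<^sub>2\<^sup>Y\<close>. Double counting gives
  \<open>\<Sum> g\<close>, \<open>\<Sum> h\<close> and \<open>\<Sum> g h\<close> (a vertex of \<open>N\<^sub>2(z)\<close> and one of \<open>N\<^sub>4(z)\<close> have all their common neighbours in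
  \<open>N\<^sub>3(z)\<close>), and the hypothesis says precisely that Cauchy--Schwarz for \<open>g\<close> is an equality. Hence \<open>g\<close> is
  constant, equal to \<open>\<gamma>\<^sub>3\<close>, and \<open>h = \<delta> = c\<^sub>2\<^sup>Y - \<gamma>\<^sub>3 > 0\<close>. Therefore \<open>N\<^sub>3(z) \<union> N\<^sub>4(z)\<close> is an isometric subgraph, and its
  intersection numbers can be read off, the third one of the second row by counting paths of length \<open>3\<close>.
  From \<open>b\<^sub>3\<^sup>Z > \<delta>\<close> each vertex of \<open>N\<^sub>3(z)\<close> has eccentricity \<open>4\<close> in it. For \<open>N\<^sub>4(z)\<close> this is a divisibility argument.
\<close>

section \<open>Distances in digraphs and induced subgraphs\<close>

context wf_digraph begin

lemma gdist_le_length: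
  assumes "awalk u p v"
  shows "gdist G u v \<le> ereal (real (length p))"
proof -
  have "awalk_cost (\<lambda>_. 1) p = real (length p)" by (induction p) auto
  then show ?thesis using min_cost_le_walk_cost[OF assms, of "\<lambda>_. 1"] by (simp add: gdist_def)
qed

text \<open>\<open>gdist\<close> is an infimum over walks, but walk lengths are naturals, so a
  shortest walk attains it. Later arguments can thus cut and extend a concrete walk.\<close>

lemma gdist_attained:
  assumes "gdist G u v \<noteq> \<infinity>"
  obtains p where "awalk u p v" "gdist G u v = ereal (real (length p))"
proof -
  have "u \<rightarrow>\<^sup>* v" using assms \<mu>_reach_conv[of "\<lambda>_. 1" u v] by (simp add: gdist_def)
  then obtain q where "awalk u q v" by (auto simp: reachable_awalk)
  then obtain p where p: "awalk u p v" "\<And>q. awalk u q v \<Longrightarrow> length p \<le> length q"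
    using ex_has_least_nat[of "\<lambda>p. awalk u p v" q length] by blast
  have cost: "awalk_cost (\<lambda>_. 1) p = real (length p)" for p :: "'b list" by (induction p) auto
  have "ereal (real (length p)) \<le> gdist G u v"
    unfolding gdist_def \<mu>_def by (rule INF_greatest) (auto simp: cost p(2))
  then show ?thesis using that[OF p(1)] gdist_le_length[OF p(1)] by (auto intro: antisym)
qed

lemma gdist_nat:
  assumes "gdist G u v \<le> ereal r"
  obtains n where "gdist G u v = ereal (real n)"
proof -
  have "gdist G u v \<noteq> \<infinity>" using assms by auto
  then show ?thesis using gdist_attained that by metis
qed

lemma gdist_nonneg: "0 \<le> gdist G u v"
proof (cases "gdist G u v = \<infinity>")
  case False
  then show ?thesis using gdist_attained[of u v] by (metis ereal_less_eq(5) of_nat_0_le_iff)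
qed simp

lemma gdist_self: "u \<in> verts G \<Longrightarrow> gdist G u u = 0"
  using gdist_le_length[of u "[]" u] gdist_nonneg[of u u]
  by (simp add: awalk_Nil_iff zero_ereal_def)

lemma gdist_0:
  assumes "gdist G u v = 0"
  shows "u = v"
proof -
  have "gdist G u v \<noteq> \<infinity>" using assms by simp
  then obtain p where p: "awalk u p v" "gdist G u v = ereal (real (length p))" by (rule gdist_attained)
  then have "p = []" using assms by (simp add: zero_ereal_def)
  then show ?thesis using p(1) by (simp add: awalk_Nil_iff)
qed

lemma gdist_step:
  assumes "gdist G a u \<le> ereal (real n)" "u \<rightarrow>\<^bsub>G\<^esub> w"
  shows "gdist G a w \<le> ereal (real (Suc n))"
proof -
  have "gdist G a u \<noteq> \<infinity>" using assms(1) by auto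
  then obtain p where p: "awalk a p u" "gdist G a u = ereal (real (length p))" by (rule gdist_attained)
  obtain e where "e \<in> arcs G" "tail G e = u" "head G e = w" using assms(2) by (rule reachableE)
  then have "awalk u [e] w" by (auto simp: awalk_simps)
  then have "awalk a (p @ [e]) w" using p(1) awalk_appendI by blast
  then have "gdist G a w \<le> ereal (real (Suc (length p)))" using gdist_le_length[of a "p @ [e]" w] by simp
  moreover have "length p \<le> n" using p(2) assms(1) by simp
  ultimately show ?thesis by (meson Suc_le_mono dual_order.trans ereal_less_eq(3) of_nat_mono)
qed

text \<open>Drop the last arc of a shortest walk: a shorter walk to \<open>u\<close>, extended by
  that arc, would give a shorter walk to \<open>w\<close>.\<close>

lemma gdist_pred:
  assumes "gdist G a w = ereal (real (Suc n))"
  shows "\<exists>u. u \<rightarrow>\<^bsub>G\<^esub> w \<and> gdist G a u = ereal (real n)"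
proof -
  have "gdist G a w \<noteq> \<infinity>" using assms by simp
  then obtain p where p: "awalk a p w" "gdist G a w = ereal (real (length p))" by (rule gdist_attained)
  then have "length p = Suc n" using assms by simp
  then obtain q e where qe: "p = q @ [e]" "length q = n" by (metis length_Suc_conv_rev)
  define u where "u = awlast a q"
  have q: "awalk a q u" "awalk u [e] w" using p qe by (auto simp: u_def)
  have adj: "u \<rightarrow>\<^bsub>G\<^esub> w" using q(2) by (auto simp: awalk_simps arcs_ends_conv)
  have le: "gdist G a u \<le> ereal (real n)" using gdist_le_length[OF q(1)] qe by simp
  then obtain r where r: "gdist G a u = ereal (real r)" by (rule gdist_nat)
  then have "gdist G a w \<le> ereal (real (Suc r))" using gdist_step[OF _ adj, of a r] by simp
  then have "n \<le> r" using assms by simp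
  then show ?thesis using adj le r by auto
qed

end

lemma (in sym_digraph) awalk_reverse:
  "awalk u p v \<Longrightarrow> \<exists>q. awalk v q u \<and> length q = length p"
proof (induction p arbitrary: u)
  case Nil
  then show ?case by (auto simp: awalk_Nil_iff)
next
  case (Cons e p)
  then have e: "e \<in> arcs G" "u = tail G e" "awalk (head G e) p v" by (auto simp: awalk_Cons_iff)
  obtain q where q: "awalk v q (head G e)" "length q = length p" using Cons.IH[OF e(3)] by blast
  obtain e' where "e' \<in> arcs G" "tail G e' = head G e" "head G e' = u"
    using sym_arcs e unfolding symmetric_conv by metis
  then have "awalk (head G e) [e'] u" by (auto simp: awalk_simps)
  then show ?case using q awalk_appendI by (intro exI[of _ "q @ [e']"]) auto
qed

lemma (in sym_digraph) gdist_sym: "gdist G u v = gdist G v u"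
proof -
  have "gdist G v u \<le> gdist G u v" for u v
  proof (cases "gdist G u v = \<infinity>")
    case False
    then obtain p where p: "awalk u p v" "gdist G u v = ereal (real (length p))" by (rule gdist_attained)
    then show ?thesis using awalk_reverse[OF p(1)] gdist_le_length[of v _ u] by metis
  qed simp
  then show ?thesis by (auto intro: antisym)
qed

lemma (in wf_digraph) dominates_induce_subgraph:
  "u \<rightarrow>\<^bsub>G \<restriction> S\<^esub> v \<longleftrightarrow> u \<in> S \<and> v \<in> S \<and> u \<rightarrow>\<^bsub>G\<^esub> v"
  by (auto simp: arcs_ends_conv)

text \<open>Two inductions on the distance. The assumption \<open>iso\<close> lets a geodesic from
  \<open>a\<close> be traced backwards without leaving \<open>S\<close>, which bounds the induced
  distance from above; the other bound holds because arcs of the subgraph are arcs of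
  \<open>G\<close>.\<close>

lemma (in wf_digraph) gdist_isometric:
  assumes S: "S \<subseteq> verts G" and a: "a \<in> S"
    and fin: "\<And>w. w \<in> S \<Longrightarrow> gdist G a w \<noteq> \<infinity>"
    and iso: "\<And>w n. w \<in> S \<Longrightarrow> gdist G a w = ereal (real (Suc n)) \<Longrightarrow>
        \<exists>u \<in> S. u \<rightarrow>\<^bsub>G\<^esub> w \<and> gdist G a u = ereal (real n)"
    and w: "w \<in> S"
  shows "gdist (G \<restriction> S) a w = gdist G a w"
proof -
  interpret H: wf_digraph "G \<restriction> S" by (rule wellformed_induce_subgraph)
  have le: "gdist (G \<restriction> S) a w \<le> ereal (real n)" if "gdist G a w = ereal (real n)" "w \<in> S" for n w
    using that
  proof (induction n arbitrary: w)
    case 0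
    then have "a = w" using gdist_0[of a w] by (simp add: zero_ereal_def)
    then show ?case using H.gdist_self[of a] a by (simp add: zero_ereal_def)
  next
    case (Suc n)
    then obtain u where u: "u \<in> S" "u \<rightarrow>\<^bsub>G\<^esub> w" "gdist G a u = ereal (real n)" using iso by blast
    then show ?case using Suc H.gdist_step[of a u n w] dominates_induce_subgraph by blast
  qed
  have ge: "gdist G a w \<le> ereal (real n)" if "gdist (G \<restriction> S) a w = ereal (real n)" for n w
    using that
  proof (induction n arbitrary: w)
    case 0
    then have "a = w" using H.gdist_0[of a w] by (simp add: zero_ereal_def)
    then show ?case using gdist_self[of a] a S by (auto simp: zero_ereal_def)
  next
    case (Suc n)
    then obtain u where u: "u \<rightarrow>\<^bsub>G \<restriction> S\<^esub> w" "gdist (G \<restriction> S) a u = ereal (real n)"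
      using H.gdist_pred by blast
    then show ?case using Suc gdist_step[of a u n w] dominates_induce_subgraph by blast
  qed
  obtain p where p: "gdist G a w = ereal (real p)" using gdist_attained[OF fin[OF w]] by metis
  have 1: "gdist (G \<restriction> S) a w \<le> gdist G a w" using le[OF p w] p by simp
  then obtain q where q: "gdist (G \<restriction> S) a w = ereal (real q)"
    unfolding p by (rule H.gdist_nat)
  then show ?thesis using 1 ge[OF q] by (auto intro: antisym)
qed

lemma (in graph) graph_induce_subgraph:
  assumes "S \<subseteq> verts G"
  shows "graph (G \<restriction> S)"
proof -
  have i: "induced_subgraph (G \<restriction> S) G" using assms by (rule induced_induce)
  interpret H: digraph "G \<restriction> S" using i by (rule digraphI_induced)
  show ?thesis by (rule H.graphI) (rule induced_graph_imp_symmetric[OF sym_arcs i])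
qed

text \<open>Without parallel arcs \<open>head G\<close> is injective on the arcs leaving
  \<open>a\<close>, so arcs may be counted as neighbours.\<close>

lemma (in digraph) out_degree_eq_card: "out_degree G a = card {u. a \<rightarrow>\<^bsub>G\<^esub> u}"
proof -
  have "{u. a \<rightarrow>\<^bsub>G\<^esub> u} = head G ` out_arcs G a" by (auto simp: arcs_ends_conv)
  moreover have "inj_on (head G) (out_arcs G a)"
    by (rule inj_onI) (auto intro: no_multi_arcs simp: arc_to_ends_def)
  ultimately show ?thesis by (simp add: out_degree_def card_image)
qed

section \<open>Bipartite graphs: parity of distances, intersection numbers and array rows\<close>

lemma bipartite_gdist_parity:
  assumes bip: "bipartite_graph G P Q" and a: "a \<in> P"
  shows "gdist G a w = ereal (real n) \<Longrightarrow> (even n \<longrightarrow> w \<in> P) \<and> (odd n \<longrightarrow> w \<in> Q)"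
proof (induction n arbitrary: w)
  case 0
  interpret graph G using bip by (simp add: bipartite_graph_def)
  show ?case using gdist_0[of a w] 0 a by (simp add: zero_ereal_def)
next
  case (Suc n)
  interpret graph G using bip by (simp add: bipartite_graph_def)
  obtain u where u: "u \<rightarrow>\<^bsub>G\<^esub> w" "gdist G a u = ereal (real n)" using gdist_pred[OF Suc.prems] by blast
  have "u \<in> P \<and> w \<in> Q \<or> u \<in> Q \<and> w \<in> P" "P \<inter> Q = {}" using bip u(1) by (auto simp: bipartite_graph_def)
  then show ?case using Suc.IH[OF u(2)] by auto
qed

text \<open>Distances from \<open>a\<close> to two adjacent vertices differ by at most one, and by
  parity they are not equal, so no neighbour escapes the two counts.\<close>

lemma out_degree_eq_counts:
  assumes bip: "bipartite_graph G P Q" and a: "a \<in> P" and w: "w \<in> nbhd G i a"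
  shows "out_degree G w = c_count G i a w + b_count G i a w"
proof -
  interpret graph G using bip by (simp add: bipartite_graph_def)
  have disj: "P \<inter> Q = {}" using bip by (simp add: bipartite_graph_def)
  have dw: "gdist G a w = ereal (real i)" using w by (simp add: nbhd_def)
  have split: "gdist G a u = ereal (real i - 1) \<or> gdist G a u = ereal (real i + 1)"
    if "w \<rightarrow>\<^bsub>G\<^esub> u" for u
  proof -
    have "gdist G a u \<le> ereal (real (Suc i))" using gdist_step[OF _ that] dw by simp
    then obtain n where n: "gdist G a u = ereal (real n)" by (rule gdist_nat)
    have "n \<le> Suc i" using \<open>gdist G a u \<le> _\<close> n by simp
    moreover have "u \<rightarrow>\<^bsub>G\<^esub> w" using that sym_arcs arcs_ends_symmetric by metis
    then have "gdist G a w \<le> ereal (real (Suc n))" using gdist_step[of a u n w] n by simp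
    then have "i \<le> Suc n" using dw by simp
    moreover have "n \<noteq> i"
    proof
      assume "n = i"
      moreover have "w \<in> P \<and> u \<in> Q \<or> w \<in> Q \<and> u \<in> P" using bip that by (auto simp: bipartite_graph_def)
      ultimately show False
        using bipartite_gdist_parity[OF bip a dw] bipartite_gdist_parity[OF bip a n] disj by auto
    qed
    ultimately have "n = Suc i \<or> i = Suc n" by linarith
    then show ?thesis using n by auto
  qed
  let ?C = "{u \<in> verts G. w \<rightarrow>\<^bsub>G\<^esub> u \<and> gdist G a u = ereal (real i - 1)}"
  let ?B = "{u \<in> verts G. w \<rightarrow>\<^bsub>G\<^esub> u \<and> gdist G a u = ereal (real i + 1)}"
  have "{u. w \<rightarrow>\<^bsub>G\<^esub> u} = ?C \<union> ?B" using split adj_in_verts by blast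
  then have "out_degree G w = card (?C \<union> ?B)" unfolding out_degree_eq_card by (rule arg_cong)
  also have "\<dots> = card ?C + card ?B" by (rule card_Un_disjoint) auto
  finally show ?thesis unfolding c_count_def b_count_def .
qed

text \<open>An array does not list the numbers \<open>b\<close>. They are recovered as valency minus
  \<open>c\<close>, since the valency of \<open>w\<close> is fixed by its part, hence by the parity
  of \<open>i\<close>.\<close>

lemma counts_of_array_rows:
  assumes bip: "bipartite_graph G P Q" and rP: "array_row G P (k, cs)" and rQ: "array_row G Q (l, ds)"
  shows "\<exists>c b. \<forall>a\<in>P. \<forall>w\<in>nbhd G i a. c_count G i a w = c \<and> b_count G i a w = b"
proof -
  interpret graph G using bip by (simp add: bipartite_graph_def)
  \<comment> \<open>Rows begin with the entry for distance 1, so \<open>i = 0\<close> gets its own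
    value: no vertex is at distance -1 from \<open>a\<close>, hence the count is 0.\<close>
  define C where "C = (if i = 0 then 0 else cs ! (i - 1))"
  define D where "D = (if even i then k else l)"
  have "real (c_count G i a w) = C \<and> real (b_count G i a w) = D - C"
    if a: "a \<in> P" and w: "w \<in> nbhd G i a" for a w
  proof -
    have dw: "gdist G a w = ereal (real i)" "w \<in> verts G" using w by (auto simp: nbhd_def)
    have row: "eccentricity G a = ereal (real (length cs))"
      "\<And>i w. i \<in> {1..length cs} \<Longrightarrow> w \<in> nbhd G i a \<Longrightarrow> real (c_count G i a w) = cs ! (i - 1)"
      using rP a by (auto simp: array_row_def)
    have "gdist G a w \<le> eccentricity G a" unfolding eccentricity_def using dw(2) by (rule SUP_upper)
    then have le: "i \<le> length cs" using row(1) dw(1) by simp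
    have C: "real (c_count G i a w) = C"
    proof (cases "i = 0")
      case True
      have "gdist G a u \<noteq> ereal (- 1)" for u using gdist_nonneg[of a u] by auto
      then show ?thesis using True by (simp add: C_def c_count_def)
    next
      case False
      then show ?thesis using row(2)[of i w] le w by (simp add: C_def)
    qed
    have "w \<in> (if even i then P else Q)" using bipartite_gdist_parity[OF bip a dw(1)] by auto
    then have "real (out_degree G w) = D"
      using rP rQ by (auto simp: array_row_def D_def split: if_splits)
    then show ?thesis using out_degree_eq_counts[OF bip a w] C by simp
  qed
  \<comment> \<open>Array entries are reals while the witnesses must be naturals; the floor recovers
    them from \<open>C\<close> and \<open>D - C\<close>.\<close>
  then have "\<forall>a\<in>P. \<forall>w\<in>nbhd G i a. c_count G i a w = nat \<lfloor>C\<rfloor> \<and> b_count G i a w = nat \<lfloor>D - C\<rfloor>"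
    by (metis floor_of_nat nat_int)
  then show ?thesis by blast
qed

lemma distance_biregular_of_array_rows:
  assumes "bipartite_graph G P Q" "array_row G P (k, cs)" "array_row G Q (l, ds)"
  shows "distance_biregular G P Q"
proof -
  have "bipartite_graph G Q P" using assms(1) by (auto simp: bipartite_graph_def)
  then show ?thesis
    using assms counts_of_array_rows[of G P Q k cs l ds] counts_of_array_rows[of G Q P l ds k cs]
    by (simp add: distance_biregular_def)
qed

text \<open>An infinite distance would become 0 here. Wherever a row with its finite eccentricity is
  given, \<open>gdist_eq_ndist\<close> excludes this case.\<close>

definition ndist :: "('a, 'b) pre_digraph \<Rightarrow> 'a \<Rightarrow> 'a \<Rightarrow> nat" where
  "ndist G a w = nat \<lfloor>real_of_ereal (gdist G a w)\<rfloor>"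

lemma ndist_eq: "gdist G a w = ereal (real n) \<Longrightarrow> ndist G a w = n"
  by (simp add: ndist_def)

context
  fixes G :: "('a, 'b) pre_digraph" and P Q :: "'a set" and k :: real and cs :: "real list" and a :: 'a
  assumes bip: "bipartite_graph G P Q" and row: "array_row G P (k, cs)" and a: "a \<in> P"
begin

interpretation graph G using bip by (simp add: bipartite_graph_def)

lemma gdist_eq_ndist:
  assumes "w \<in> verts G"
  shows "gdist G a w = ereal (real (ndist G a w))" "ndist G a w \<le> length cs"
proof -
  have ecc: "eccentricity G a = ereal (real (length cs))" using row a by (auto simp: array_row_def)
  have "gdist G a w \<le> eccentricity G a" unfolding eccentricity_def using assms by (rule SUP_upper)
  then have le: "gdist G a w \<le> ereal (real (length cs))" using ecc by simp
  then obtain n where "gdist G a w = ereal (real n)" by (rule gdist_nat)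
  then show "gdist G a w = ereal (real (ndist G a w))" "ndist G a w \<le> length cs"
    using le by (simp_all add: ndist_eq)
qed

lemma nbhd_ndist: "nbhd G i a = {w \<in> verts G. ndist G a w = i}"
  using gdist_eq_ndist(1) by (auto simp: nbhd_def)

text \<open>Distances are integral, so the supremum defining the eccentricity is a maximum; a
  geodesic to a farthest vertex meets all smaller distances. Hence the induction runs downwards from
  \<open>length cs\<close>.\<close>

lemma ex_ndist:
  assumes "i \<le> length cs"
  shows "\<exists>w \<in> verts G. ndist G a w = i"
  using assms
proof (induction rule: inc_induct)
  case base
  show ?case
  proof (rule ccontr)
    assume none: "\<not> ?case"
    have aV: "a \<in> verts G" using a bip by (auto simp: bipartite_graph_def)
    \<comment> \<open>The bound \<open>length cs > 0\<close> is carried along because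
      \<open>length cs - 1\<close> is a truncated difference.\<close>
    have "ndist G a w \<le> length cs - 1" "length cs > 0" if "w \<in> verts G" for w
      using gdist_eq_ndist(2)[OF that] none that by force+
    then have "gdist G a w \<le> ereal (real (length cs - 1))" "length cs > 0" if "w \<in> verts G" for w
      using gdist_eq_ndist(1) that by auto
    then have "eccentricity G a \<le> ereal (real (length cs - 1))" "length cs > 0"
      unfolding eccentricity_def using aV by (auto intro: SUP_least)
    moreover have "eccentricity G a = ereal (real (length cs))" using row a by (auto simp: array_row_def)
    ultimately show False by simp
  qed
next
  case (step n)
  then obtain w where "w \<in> verts G" "ndist G a w = Suc n" by blast
  then have "gdist G a w = ereal (real (Suc n))" using gdist_eq_ndist(1) by metis
  then show ?case using gdist_pred ndist_eq adj_in_verts by metis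
qed

lemma c_count_ndist: "c_count G (Suc i) a w = card {u. w \<rightarrow>\<^bsub>G\<^esub> u \<and> ndist G a u = i}"
proof -
  have "gdist G a u = ereal (real (Suc i) - 1) \<longleftrightarrow> ndist G a u = i" if "w \<rightarrow>\<^bsub>G\<^esub> u" for u
    using gdist_eq_ndist(1)[of u] adj_in_verts(2)[OF that] by simp
  then have "{u \<in> verts G. w \<rightarrow>\<^bsub>G\<^esub> u \<and> gdist G a u = ereal (real (Suc i) - 1)} = {u. w \<rightarrow>\<^bsub>G\<^esub> u \<and> ndist G a u = i}"
    using adj_in_verts(2) by blast
  then show ?thesis unfolding c_count_def by (rule arg_cong)
qed

lemma array_row_entry:
  assumes "w \<in> verts G" "ndist G a w = Suc i"
  shows "real (card {u. w \<rightarrow>\<^bsub>G\<^esub> u \<and> ndist G a u = i}) = cs ! i"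
proof -
  have "w \<in> nbhd G (Suc i) a" using assms by (simp add: nbhd_ndist)
  moreover have "Suc i \<in> {1..length cs}" using gdist_eq_ndist(2)[OF assms(1)] assms(2) by simp
  ultimately have "real (c_count G (Suc i) a w) = cs ! (Suc i - 1)"
    using row a unfolding array_row_def by blast
  then show ?thesis by (simp add: c_count_ndist)
qed

text \<open>Every listed distance occurs, so every entry is the cardinality of some actual set. This
  permits natural parameters in the counting arguments.\<close>

lemma array_row_entry_nat:
  assumes "i < length cs"
  shows "\<exists>n. cs ! i = real n"
proof -
  obtain w where "w \<in> verts G" "ndist G a w = Suc i" using ex_ndist[of "Suc i"] assms by auto
  then show ?thesis using array_row_entry by metis
qed

end

text \<open>A row can be checked through any integral function \<open>f\<close> that gives the
  distances from \<open>P\<close>. For the induced subgraph, \<open>f\<close> will be the distance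
  of the ambient graph.\<close>

lemma array_rowI:
  assumes G: "graph G"
    and fin: "\<And>a w. a \<in> P \<Longrightarrow> w \<in> verts G \<Longrightarrow> gdist G a w = ereal (real (f a w))"
    and le: "\<And>a w. a \<in> P \<Longrightarrow> w \<in> verts G \<Longrightarrow> f a w \<le> length cs"
    and ex: "\<And>a. a \<in> P \<Longrightarrow> \<exists>w \<in> verts G. f a w = length cs"
    and deg: "\<And>a. a \<in> P \<Longrightarrow> real (card {u \<in> verts G. a \<rightarrow>\<^bsub>G\<^esub> u}) = k"
    and c: "\<And>a w i. a \<in> P \<Longrightarrow> w \<in> verts G \<Longrightarrow> f a w = Suc i \<Longrightarrow>
        real (card {u \<in> verts G. w \<rightarrow>\<^bsub>G\<^esub> u \<and> f a u = i}) = cs ! i"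
  shows "array_row G P (k, cs)"
proof -
  interpret graph G by (rule G)
  have "real (out_degree G a) = k" if "a \<in> P" for a
  proof -
    have "{u. a \<rightarrow>\<^bsub>G\<^esub> u} = {u \<in> verts G. a \<rightarrow>\<^bsub>G\<^esub> u}" using adj_in_verts by blast
    then show ?thesis using deg[OF that] by (simp add: out_degree_eq_card)
  qed
  moreover have "eccentricity G a = ereal (real (length cs))" if "a \<in> P" for a
  proof (rule antisym)
    show "eccentricity G a \<le> ereal (real (length cs))"
      unfolding eccentricity_def using fin le that by (auto intro!: SUP_least)
    obtain w where w: "w \<in> verts G" "f a w = length cs" using ex[OF \<open>a \<in> P\<close>] by blast
    have "gdist G a w \<le> eccentricity G a" unfolding eccentricity_def using w(1) by (rule SUP_upper)
    then show "ereal (real (length cs)) \<le> eccentricity G a" using fin[OF that w(1)] w(2) by simp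
  qed
  moreover have "real (c_count G i a w) = cs ! (i - 1)"
    if "a \<in> P" "i \<in> {1..length cs}" "w \<in> nbhd G i a" for a i w
  proof -
    obtain j where j: "i = Suc j" using \<open>i \<in> {1..length cs}\<close> by (cases i) auto
    have w: "w \<in> verts G" "f a w = Suc j" using that(3) fin[OF that(1)] j by (auto simp: nbhd_def)
    have "{u \<in> verts G. w \<rightarrow>\<^bsub>G\<^esub> u \<and> gdist G a u = ereal (real i - 1)}
        = {u \<in> verts G. w \<rightarrow>\<^bsub>G\<^esub> u \<and> f a u = j}"
      using fin[OF that(1)] j by auto
    then show ?thesis using c[OF that(1) w] j by (simp add: c_count_def)
  qed
  ultimately show ?thesis by (simp add: array_row_def)
qed

section \<open>Counting around a vertex\<close>

text \<open>These would be the parameters if some vertex of \<open>N\<^sub>4(z)\<close> had no vertex of \<open>N\<^sub>4(z)\<close> at distance \<open>4\<close>.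
  For \<open>c > 1\<close> they satisfy \<open>c \<gamma> = \<delta> (c \<delta> - 1)\<close>, so that \<open>c\<close> divides \<open>\<delta>\<close>, whereas \<open>e < l\<close> forces \<open>\<delta> < c\<close>.\<close>

lemma no_extremal_parameters:
  fixes c c' c3 b3 b2 l e k gam del m n2 n3 :: int
  assumes pos: "1 \<le> c" "1 \<le> c3" "1 \<le> b2" "1 \<le> e" "e < l" "1 \<le> c'" "0 \<le> gam" "0 < del" "del < b3"
    and l: "l = c + b2" and k: "k = c3 + b3" and c': "c' = gam + del"
    and i: "b3 * c = del * e"
    and ii: "(m - 1) * c = l * (b3 - 1)"
    and iii: "l * (k - 1) = n2 * c" "n2 * b2 = n3 * c3" "n3 * b3 = m * l"
    and iv: "c' * e = c * c3"
    and v: "(b2 - 1) * (l - 1) * c' = (b3 * (l - 1) + c3 * (b2 - 1)) * (c - 1)"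
    and vi: "gam * (b3 * (l - 1) + c3 * (b2 - 1)) = c' * c3 * (b2 - 1)"
  shows False
proof -
  \<comment> \<open>This is the denominator of gamma_3. The letters \<open>c\<close>,
    \<open>c'\<close>, \<open>c3\<close>, \<open>e\<close>, \<open>m\<close>, \<open>n2\<close>,
    \<open>n3\<close> stand for \<open>cZ2\<close>, \<open>cY2\<close>, \<open>cZ3\<close>,
    \<open>cY3\<close> and the sizes of \<open>N4\<close>, \<open>N2\<close>,
    \<open>N3\<close>.\<close>
  define D where "D = b3 * (l - 1) + c3 * (b2 - 1)"
  have b3: "b3 \<ge> 2" using pos by linarith
  have l2: "l \<ge> 2" using pos l by linarith
  have "b3 * (l - 1) > 0" "c3 * (b2 - 1) \<ge> 0" using b3 l2 pos by simp_all
  then have D0: "D > 0" by (simp add: D_def)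
  \<comment> \<open>Counterpart of \<open>vi\<close>: \<open>gam\<close> and \<open>del\<close>
    divide \<open>c'\<close> in the ratio of \<open>c3 * (b2 - 1)\<close> to
    \<open>b3 * (l - 1)\<close>.\<close>
  have dD: "del * D = c' * b3 * (l - 1)"
  proof -
    have "del * D = c' * D - gam * D" unfolding c' by (simp add: algebra_simps)
    also have "gam * D = c' * c3 * (b2 - 1)" using vi by (simp add: D_def)
    finally show ?thesis by (simp add: D_def algebra_simps)
  qed
  have v': "(b2 - 1) * (l - 1) * c' = D * (c - 1)" and vi': "gam * D = c' * c3 * (b2 - 1)"
    using v vi by (simp_all add: D_def)
  show False
  proof (cases "c = 1")
    case True
    then have "b2 = 1" using v' l2 pos by simp
    then have "l = 2" "e = 1" using l True pos by simp_all
    moreover have "gam = 0" using vi' D0 \<open>b2 = 1\<close> by simp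
    ultimately show False using i True pos by simp
  next
    case False
    then have c2: "c \<ge> 2" using pos by linarith
    have b2: "b2 - 1 > 0" using v' D0 c2 pos by (cases "b2 = 1") auto
    \<comment> \<open>Eliminating \<open>D\<close> between \<open>v'\<close> and the formulas for
      \<open>del\<close> and \<open>gam\<close> yields the two short relations \<open>al\<close> and
      \<open>be\<close>.\<close>
    have "(c' * (l - 1)) * (del * (b2 - 1)) = del * (D * (c - 1))" unfolding v'[symmetric] by (simp only: mult_ac)
    also have "\<dots> = (c' * (l - 1)) * (b3 * (c - 1))" unfolding mult.assoc[symmetric] dD by (simp only: mult_ac)
    finally have al: "del * (b2 - 1) = b3 * (c - 1)" using l2 pos by simp
    have "(c' * (b2 - 1)) * (gam * (l - 1)) = gam * (D * (c - 1))" unfolding v'[symmetric] by (simp only: mult_ac)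
    also have "\<dots> = (c' * (b2 - 1)) * (c3 * (c - 1))" unfolding mult.assoc[symmetric] vi' by (simp only: mult_ac)
    finally have be: "gam * (l - 1) = c3 * (c - 1)" using b2 pos by simp
    have "(b3 * c) * D = e * (del * D)" unfolding i by (simp only: mult_ac)
    also have "\<dots> = (c' * e) * (b3 * (l - 1))" unfolding dD by (simp only: mult_ac)
    also have "\<dots> = (b3 * c) * (c3 * (l - 1))" unfolding iv by (simp only: mult_ac)
    finally have "D = c3 * (l - 1)" using b3 pos by simp
    then have cc: "c3 * c = b3 * (l - 1)" unfolding D_def l by (simp add: algebra_simps)
    \<comment> \<open>Chaining the three relations in \<open>iii\<close> eliminates the sphere sizes
      \<open>n2\<close> and \<open>n3\<close>.\<close>
    have "(l * (b3 * (l - 1))) * m = (m * l) * (c3 * c)" unfolding cc by (simp only: mult_ac)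
    also have "\<dots> = (n3 * c3) * (b3 * c)" unfolding iii(3)[symmetric] by (simp only: mult_ac)
    also have "\<dots> = (n2 * c) * (b2 * b3)" unfolding iii(2)[symmetric] by (simp only: mult_ac)
    also have "\<dots> = (l * b3) * ((k - 1) * b2)" unfolding iii(1)[symmetric] by (simp only: mult_ac)
    finally have "(l * b3) * (m * (l - 1)) = (l * b3) * ((k - 1) * b2)" by (simp only: mult_ac)
    then have m: "m * (l - 1) = (k - 1) * b2" using b3 l2 by simp
    have "b3 * (c * (c - 1)) = b2 * (b2 - 1)"
    proof -
      have "m * c = c + l * (b3 - 1)" using ii by (simp add: algebra_simps)
      then have "(c + l * (b3 - 1)) * (l - 1) = (m * (l - 1)) * c" by (metis mult.commute mult.left_commute)
      also have "\<dots> = (c3 * c + b3 * c - c) * b2" unfolding m k by (simp add: algebra_simps)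
      finally have "(c + l * (b3 - 1)) * (l - 1) = (b3 * (l - 1) + b3 * c - c) * b2" unfolding cc .
      then show ?thesis unfolding l by (simp add: algebra_simps)
    qed
    then have "(del * c) * (b2 - 1) = b2 * (b2 - 1)" using al by (simp add: mult_ac)
    then have dc: "del * c = b2" using b2 by simp
    have "(c * gam) * (l - 1) = (c3 * c) * (c - 1)" using be by (simp add: mult_ac)
    also have "\<dots> = (b3 * (c - 1)) * (l - 1)" unfolding cc by (simp only: mult_ac)
    finally have cg: "c * gam = del * (del * c - 1)" using l2 al dc by simp
    then have "del = c * (del * del - gam)" by (simp add: algebra_simps)
    then have "c dvd del" by (metis dvd_triv_left)
    then have dge: "c \<le> del" using pos by (simp add: zdvd_imp_le)
    \<comment> \<open>The opposite estimate: \<open>e \<le> l - 1\<close> leads to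
      \<open>del * c - 1 \<le> c * (c - 1)\<close>, which is incompatible with
      \<open>c \<le> del\<close> and \<open>c \<ge> 2\<close>.\<close>
    have "(c * gam) * (l - 1) = (c' * e) * (c - 1)" unfolding iv using be by (simp add: mult_ac)
    also have "\<dots> \<le> (c' * (l - 1)) * (c - 1)"
      using pos c2 by (intro mult_right_mono mult_left_mono) auto
    finally have "(c * gam) * (l - 1) \<le> (c' * (c - 1)) * (l - 1)" by (simp only: mult_ac)
    then have "c * gam \<le> c' * (c - 1)" using l2 by simp
    then have "gam \<le> (c - 1) * del" unfolding c' by (simp add: algebra_simps)
    then have "c * gam \<le> c * ((c - 1) * del)" using pos by simp
    then have "del * (del * c - 1) \<le> del * (c * (c - 1))" unfolding cg by (simp add: mult_ac)
    then have "del * c - 1 \<le> c * (c - 1)" using pos by simp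
    then have "del * c - 1 \<le> c * c - c" by (simp only: right_diff_distrib mult_1_right)
    moreover have "c * c \<le> del * c" using dge pos by simp
    ultimately show False using c2 by linarith
  qed
qed

text \<open>Abstract setting with a natural-valued distance and natural parameters, so that double
  counting needs neither \<open>ereal\<close> nor arcs. It is instantiated with
  \<open>ndist G\<close>.\<close>

locale biregular_four =
  fixes adj :: "'a \<Rightarrow> 'a \<Rightarrow> bool" and d :: "'a \<Rightarrow> 'a \<Rightarrow> nat" and Y Z :: "'a set"
    and k l cY2 cY3 cZ2 cZ3 :: nat and z :: 'a
  assumes fin_Y: "finite Y" and fin_Z: "finite Z" and disj: "Y \<inter> Z = {}"
    and adj_sym: "adj u v \<Longrightarrow> adj v u"
    and adj_parts: "adj u v \<Longrightarrow> u \<in> Y \<and> v \<in> Z \<or> u \<in> Z \<and> v \<in> Y"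
    and d_le: "a \<in> Y \<union> Z \<Longrightarrow> w \<in> Y \<union> Z \<Longrightarrow> d a w \<le> 4"
    and d_sym: "a \<in> Y \<union> Z \<Longrightarrow> w \<in> Y \<union> Z \<Longrightarrow> d a w = d w a"
    and d_eq_0: "a \<in> Y \<union> Z \<Longrightarrow> w \<in> Y \<union> Z \<Longrightarrow> d a w = 0 \<longleftrightarrow> a = w"
    and d_step: "a \<in> Y \<union> Z \<Longrightarrow> adj u w \<Longrightarrow> d a w \<le> Suc (d a u)"
    and d_pred: "a \<in> Y \<union> Z \<Longrightarrow> w \<in> Y \<union> Z \<Longrightarrow> d a w = Suc n \<Longrightarrow> \<exists>u. adj w u \<and> d a u = n"
    and deg_Y: "y \<in> Y \<Longrightarrow> card {u. adj y u} = k"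
    and deg_Z: "w \<in> Z \<Longrightarrow> card {u. adj w u} = l"
    and cY2: "x \<in> Y \<Longrightarrow> y \<in> Y \<Longrightarrow> d x y = 2 \<Longrightarrow> card {u. adj y u \<and> d x u = 1} = cY2"
    and cY3: "x \<in> Y \<Longrightarrow> w \<in> Z \<Longrightarrow> d x w = 3 \<Longrightarrow> card {u. adj w u \<and> d x u = 2} = cY3"
    and cZ2: "v \<in> Z \<Longrightarrow> w \<in> Z \<Longrightarrow> d v w = 2 \<Longrightarrow> card {u. adj w u \<and> d v u = 1} = cZ2"
    and cZ3: "v \<in> Z \<Longrightarrow> y \<in> Y \<Longrightarrow> d v y = 3 \<Longrightarrow> card {u. adj y u \<and> d v u = 2} = cZ3"
    and ecc_Y: "y \<in> Y \<Longrightarrow> \<exists>w \<in> Y \<union> Z. d y w = 4"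
    and ecc_Z: "w \<in> Z \<Longrightarrow> \<exists>v \<in> Y \<union> Z. d w v = 4"
    and z: "z \<in> Z"
begin

section \<open>Distances, degrees and the spheres around \<open>z\<close>\<close>

lemma adj_verts: "adj u v \<Longrightarrow> u \<in> Y \<union> Z" "adj u v \<Longrightarrow> v \<in> Y \<union> Z"
  using adj_parts by blast+

lemma finite_nbrs: "finite {u. adj w u \<and> P u}"
  by (rule finite_subset[of _ "Y \<union> Z"]) (use adj_verts fin_Y fin_Z in auto)

lemma parity:
  assumes "a \<in> Y \<union> Z" "w \<in> Y \<union> Z"
  shows "even (d a w) \<longleftrightarrow> (a \<in> Y \<longleftrightarrow> w \<in> Y)"
  using assms(2)
proof (induction "d a w" arbitrary: w)
  case 0
  then show ?case using d_eq_0[OF assms(1) 0(2)] by simp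
next
  case (Suc n)
  obtain u where u: "adj w u" "d a u = n"
    using d_pred[OF assms(1) Suc.prems] Suc.hyps(2) by metis
  have "even n \<longleftrightarrow> (a \<in> Y \<longleftrightarrow> u \<in> Y)" using Suc.hyps(1)[of u] u adj_verts by auto
  moreover have "u \<in> Y \<longleftrightarrow> w \<notin> Y" using adj_parts[OF u(1)] disj by auto
  ultimately show ?case using Suc.hyps(2)[symmetric] by auto
qed

lemma d_adj:
  assumes "a \<in> Y \<union> Z" "adj u w"
  shows "d a w = Suc (d a u) \<or> d a u = Suc (d a w)"
proof -
  have "d a w \<le> Suc (d a u)" "d a u \<le> Suc (d a w)"
    using d_step assms adj_sym by blast+
  moreover have "d a w \<noteq> d a u"
    using parity[OF assms(1), of u] parity[OF assms(1), of w] adj_verts[OF assms(2)]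
      adj_parts[OF assms(2)] disj by auto
  ultimately show ?thesis by linarith
qed

lemma d_1:
  assumes "a \<in> Y \<union> Z" "w \<in> Y \<union> Z"
  shows "d a w = 1 \<longleftrightarrow> adj a w"
proof
  assume "d a w = 1"
  then obtain u where "adj w u" "d a u = 0" using d_pred[OF assms, of 0] by auto
  then show "adj a w" using d_eq_0[OF assms(1), of u] adj_verts adj_sym by auto
next
  assume "adj a w"
  then show "d a w = 1" using d_adj[OF assms(1), of a w] d_eq_0[OF assms(1,1)] by auto
qed

lemma d_2I:
  assumes "adj a u" "adj u w" "a \<noteq> w"
  shows "d a w = 2"
proof -
  have V: "a \<in> Y \<union> Z" "u \<in> Y \<union> Z" "w \<in> Y \<union> Z" using assms adj_verts by blast+
  have "d a u = 1" using d_1 V assms by blast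
  then show ?thesis using d_adj[OF V(1) assms(2)] d_eq_0[OF V(1,3)] assms(3) by auto
qed

lemma deg_split:
  assumes "a \<in> Y \<union> Z" "d a w = Suc n"
  shows "card {u. adj w u} = card {u. adj w u \<and> d a u = n} + card {u. adj w u \<and> d a u = Suc (Suc n)}"
proof -
  have "{u. adj w u} = {u. adj w u \<and> d a u = n} \<union> {u. adj w u \<and> d a u = Suc (Suc n)}"
    using d_adj[OF assms(1), of w] assms(2) by fastforce
  also have "card \<dots> = card {u. adj w u \<and> d a u = n} + card {u. adj w u \<and> d a u = Suc (Suc n)}"
    by (rule card_Un_disjoint) (auto simp: finite_nbrs)
  finally show ?thesis .
qed

lemma common_Y:
  assumes "x \<in> Y" "y \<in> Y" "d x y = 2"
  shows "card {u. adj x u \<and> adj y u} = cY2"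
proof -
  have "{u. adj x u \<and> adj y u} = {u. adj y u \<and> d x u = 1}"
    using d_1[of x] assms adj_verts by blast
  then show ?thesis using cY2[OF assms] by simp
qed

lemma common_Z:
  assumes "v \<in> Z" "w \<in> Z" "d v w = 2"
  shows "card {u. adj v u \<and> adj w u} = cZ2"
proof -
  have "{u. adj v u \<and> adj w u} = {u. adj w u \<and> d v u = 1}"
    using d_1[of v] assms adj_verts by blast
  then show ?thesis using cZ2[OF assms] by simp
qed

text \<open>Both differences are truncated; the bounds \<open>cZ2 \<le> l\<close> and
  \<open>cZ3 \<le> k\<close> proved in \<open>positive_params\<close> make them genuine.\<close>

abbreviation "b2 \<equiv> l - cZ2"
abbreviation "b3 \<equiv> k - cZ3"

definition "N2 = {u \<in> Z. d z u = 2}"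
definition "N3 = {y \<in> Y. d z y = 3}"
definition "N4 = {u \<in> Z. d z u = 4}"

lemma finite_N: "finite N2" "finite N3" "finite N4"
  using fin_Y fin_Z by (auto simp: N2_def N3_def N4_def)

lemma zV: "z \<in> Y \<union> Z" using z by auto

lemma adj_z_dist:
  assumes "adj w u"
  shows "d z w = 2 \<Longrightarrow> u \<in> Y" "d z w = 4 \<Longrightarrow> u \<in> N3" "d z w = 3 \<Longrightarrow> u \<in> N2 \<union> N4"
proof -
  have V: "u \<in> Y \<union> Z" "w \<in> Y \<union> Z" using assms adj_verts by blast+
  have z': "z \<notin> Y" using z disj by auto
  have p: "even (d z w) \<longleftrightarrow> w \<notin> Y" "even (d z u) \<longleftrightarrow> u \<notin> Y"
    using parity[OF zV] V z' by auto
  have s: "d z u = Suc (d z w) \<or> d z w = Suc (d z u)" using d_adj[OF zV assms] .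
  have le: "d z u \<le> 4" using d_le[OF zV V(1)] .
  show "d z w = 2 \<Longrightarrow> u \<in> Y" using p s by auto
  show "d z w = 4 \<Longrightarrow> u \<in> N3" using p s le by (auto simp: N3_def)
  show "d z w = 3 \<Longrightarrow> u \<in> N2 \<union> N4" using p s le V by (auto simp: N2_def N4_def)
qed

lemma N3_nbrs:
  assumes "x \<in> N3"
  shows "card {u \<in> N2. adj x u} = cZ3" "card {u \<in> N4. adj x u} = b3" "cZ3 \<le> k"
proof -
  have x: "x \<in> Y" "d z x = 3" using assms by (auto simp: N3_def)
  have 2: "{u \<in> N2. adj x u} = {u. adj x u \<and> d z u = 2}"
    using adj_parts x disj by (auto simp: N2_def)
  have 4: "{u \<in> N4. adj x u} = {u. adj x u \<and> d z u = 4}"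
    using adj_parts x disj by (auto simp: N4_def)
  show a: "card {u \<in> N2. adj x u} = cZ3" using cZ3[OF z x] 2 by simp
  have "k = card {u. adj x u \<and> d z u = 2} + card {u. adj x u \<and> d z u = 4}"
    using deg_split[OF zV, of x 2] deg_Y[OF x(1)] x(2) by (simp add: eval_nat_numeral)
  then show "card {u \<in> N4. adj x u} = b3" "cZ3 \<le> k" using a 2 4 by auto
qed

lemma N2_nbrs:
  assumes "u \<in> N2"
  shows "card {y \<in> Y. d z y = 1 \<and> adj u y} = cZ2" "card {y \<in> N3. adj u y} = b2" "cZ2 \<le> l"
proof -
  have u: "u \<in> Z" "d z u = 2" using assms by (auto simp: N2_def)
  have 1: "{y \<in> Y. d z y = 1 \<and> adj u y} = {y. adj u y \<and> d z y = 1}"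
    using adj_parts u disj by auto
  have 3: "{y \<in> N3. adj u y} = {y. adj u y \<and> d z y = 3}"
    using adj_parts u disj by (auto simp: N3_def)
  show a: "card {y \<in> Y. d z y = 1 \<and> adj u y} = cZ2" using cZ2[OF z u] 1 by simp
  have "l = card {y. adj u y \<and> d z y = 1} + card {y. adj u y \<and> d z y = 3}"
    using deg_split[OF zV, of u 1] deg_Z[OF u(1)] u(2) by (simp add: eval_nat_numeral)
  then show "card {y \<in> N3. adj u y} = b2" "cZ2 \<le> l" using a 1 3 by auto
qed

lemma N4_nbrs:
  assumes "u \<in> N4"
  shows "card {y \<in> N3. adj u y} = l" "adj u y \<Longrightarrow> y \<in> N3"
proof -
  have u: "u \<in> Z" "d z u = 4" using assms by (auto simp: N4_def)
  show *: "y \<in> N3" if "adj u y" for y using adj_z_dist(2)[OF that u(2)] .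
  then have "{y \<in> N3. adj u y} = {y. adj u y}" by auto
  then show "card {y \<in> N3. adj u y} = l" using deg_Z[OF u(1)] by simp
qed

lemma N4_nonempty: "N4 \<noteq> {}"
proof -
  obtain v where v: "v \<in> Y \<union> Z" "d z v = 4" using ecc_Z[OF z] by blast
  then have "v \<in> Z" using parity[OF zV v(1)] z disj by auto
  then show ?thesis using v by (auto simp: N4_def)
qed

lemma N4_down:
  assumes "v \<in> N4"
  shows "\<exists>x \<in> N3. adj v x"
proof -
  have "v \<in> Y \<union> Z" "d z v = Suc 3" using assms by (auto simp: N4_def)
  then obtain x where "adj v x" using d_pred[OF zV] by blast
  then show ?thesis using N4_nbrs(2)[OF assms] by blast
qed

lemma N3_down:
  assumes "x \<in> N3"
  shows "\<exists>u \<in> N2. adj x u"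
proof -
  have "x \<in> Y" "x \<in> Y \<union> Z" "d z x = Suc 2" using assms by (auto simp: N3_def)
  then obtain u where "adj x u" "d z u = 2" using d_pred[OF zV] by blast
  then show ?thesis using adj_parts[of x u] \<open>x \<in> Y\<close> disj by (auto simp: N2_def)
qed

text \<open>Each bound is witnessed by neighbours on a geodesic of length 4, starting at
  \<open>z\<close> for the numbers of \<open>Z\<close> and at some \<open>x\<close> in
  \<open>N3\<close> for those of \<open>Y\<close>. In the latter the vertex at distance 3 has a
  neighbour at distance 4, which gives \<open>cY3 < l\<close>.\<close>

lemma positive_params: "1 \<le> cZ3" "1 \<le> b3" "1 \<le> cZ2" "1 \<le> b2" "2 \<le> l" "1 \<le> cY2" "1 \<le> cY3" "cY3 < l"
  "cZ3 \<le> k" "cZ2 \<le> l"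
proof -
  obtain v x where v: "v \<in> N4" "x \<in> N3" "adj v x" using N4_nonempty N4_down by blast
  obtain u where u: "u \<in> N2" "adj x u" using N3_down v by blast
  have "finite {u \<in> N2. adj x u}" "u \<in> {u \<in> N2. adj x u}" using finite_N u by auto
  then show "1 \<le> cZ3" using N3_nbrs(1)[OF v(2)] by (metis card_gt_0_iff empty_iff One_nat_def Suc_leI)
  have "finite {u \<in> N4. adj x u}" "v \<in> {u \<in> N4. adj x u}" using finite_N v adj_sym by auto
  then show "1 \<le> b3" using N3_nbrs(2)[OF v(2)] by (metis card_gt_0_iff empty_iff One_nat_def Suc_leI)
  have "finite {y \<in> N3. adj u y}" "x \<in> {y \<in> N3. adj u y}" using finite_N v u adj_sym by auto
  then show b2: "1 \<le> b2" using N2_nbrs(2)[OF u(1)] by (metis card_gt_0_iff empty_iff One_nat_def Suc_leI)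
  obtain y where y: "adj u y" "d z y = 1" using d_pred[OF zV, of u 1] u by (auto simp: N2_def)
  then have "y \<in> Y" using adj_z_dist(1)[OF y(1)] u by (auto simp: N2_def)
  then have "finite {y \<in> Y. d z y = 1 \<and> adj u y}" "y \<in> {y \<in> Y. d z y = 1 \<and> adj u y}"
    using fin_Y y by auto
  then show c: "1 \<le> cZ2" using N2_nbrs(1)[OF u(1)] by (metis card_gt_0_iff empty_iff One_nat_def Suc_leI)
  show "2 \<le> l" using b2 c by linarith
  show "cZ3 \<le> k" "cZ2 \<le> l" using N3_nbrs(3)[OF v(2)] N2_nbrs(3)[OF u(1)] by auto
  have xY: "x \<in> Y" using v by (auto simp: N3_def)
  obtain w where w: "w \<in> Y \<union> Z" "d x w = 4" using ecc_Y[OF xY] by blast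
  then have wY: "w \<in> Y" using parity[of x w] xY by auto
  have xV: "x \<in> Y \<union> Z" using xY by auto
  obtain t where t: "adj w t" "d x t = 3" using d_pred[OF xV w(1), of 3] w by auto
  have tZ: "t \<in> Z" using adj_parts[OF t(1)] wY disj by auto
  have tV: "t \<in> Y \<union> Z" using tZ by auto
  obtain s where s: "adj t s" "d x s = 2" using d_pred[OF xV tV, of 2] t by auto
  have sY: "s \<in> Y" using adj_parts[OF s(1)] tZ disj by auto
  have sV: "s \<in> Y \<union> Z" using sY by auto
  have "s \<in> {u. adj t u \<and> d x u = 2}" using s by auto
  then show "1 \<le> cY3" using cY3[OF xY tZ t(2)] finite_nbrs[of t "\<lambda>u. d x u = 2"]
    by (metis card_gt_0_iff empty_iff One_nat_def Suc_leI)
  obtain r where r: "adj s r" "d x r = 1" using d_pred[OF xV sV, of 1] s by auto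
  then have "r \<in> {u. adj s u \<and> d x u = 1}" by auto
  then show "1 \<le> cY2" using cY2[OF xY sY s(2)] finite_nbrs[of s "\<lambda>u. d x u = 1"]
    by (metis card_gt_0_iff empty_iff One_nat_def Suc_leI)
  have "w \<in> {u. adj t u \<and> d x u = 4}" using w t adj_sym by auto
  then have "1 \<le> card {u. adj t u \<and> d x u = 4}" using finite_nbrs[of t "\<lambda>u. d x u = 4"]
    by (metis card_gt_0_iff empty_iff One_nat_def Suc_leI)
  moreover have "l = card {u. adj t u \<and> d x u = 2} + card {u. adj t u \<and> d x u = 4}"
    using deg_split[OF xV, of t 2] deg_Z[OF tZ] t(2) by (simp add: eval_nat_numeral)
  ultimately show "cY3 < l" using cY3[OF xY tZ t(2)] by linarith
qed

section \<open>Common neighbours of two vertices of \<open>N3\<close>\<close>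

definition "g x y = card {u \<in> N2. adj x u \<and> adj y u}"
definition "h x y = card {u \<in> N4. adj x u \<and> adj y u}"

lemma g_plus_h:
  assumes "x \<in> N3" "y \<in> N3" "d x y = 2"
  shows "g x y + h x y = cY2"
proof -
  have "{u. adj x u \<and> adj y u} = {u \<in> N2. adj x u \<and> adj y u} \<union> {u \<in> N4. adj x u \<and> adj y u}"
    using adj_z_dist(3)[of x] assms(1) unfolding N3_def by blast
  moreover have "card {u. adj x u \<and> adj y u} = cY2"
    using assms by (intro common_Y) (auto simp: N3_def)
  ultimately have "cY2 = card ({u \<in> N2. adj x u \<and> adj y u} \<union> {u \<in> N4. adj x u \<and> adj y u})"
    by metis
  also have "\<dots> = g x y + h x y" unfolding g_def h_def
    by (rule card_Un_disjoint) (use fin_Z in \<open>auto simp: N2_def N4_def\<close>)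
  finally show ?thesis by simp
qed

text \<open>Incidences between \<open>P\<close> and the neighbours of \<open>x\<close> are counted
  from the side of those neighbours; each \<open>- 1\<close> discards \<open>x\<close> itself. The
  product \<open>g x y * h x y\<close> counts pairs \<open>(u, v)\<close> in
  \<open>U \<times> W\<close> adjacent to \<open>y\<close>. Such \<open>u\<close> and
  \<open>v\<close> are at distance 2 through \<open>x\<close>, so they have \<open>cZ2\<close>
  common neighbours.\<close>

lemma sums_around:
  assumes x: "x \<in> N3"
  defines "P \<equiv> {y \<in> N3. d x y = 2}"
  shows "(\<Sum>y\<in>P. g x y) = (b2 - 1) * cZ3"
    and "(\<Sum>y\<in>P. h x y) = (l - 1) * b3"
    and "(\<Sum>y\<in>P. g x y * h x y) = (cZ2 - 1) * (cZ3 * b3)"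
proof -
  define U where "U = {u \<in> N2. adj x u}"
  define W where "W = {u \<in> N4. adj x u}"
  have fin: "finite P" "finite U" "finite W" using finite_N by (auto simp: P_def U_def W_def)
  have x': "x \<in> Y" "d z x = 3" using x by (auto simp: N3_def)
  have cU: "card U = cZ3" "card W = b3" using N3_nbrs[OF x] by (simp_all add: U_def W_def)
  have g: "g x y = card {u \<in> U. adj y u}" for y
    unfolding g_def U_def by (rule arg_cong[of _ _ card]) auto
  have h: "h x y = card {u \<in> W. adj y u}" for y
    unfolding h_def W_def by (rule arg_cong[of _ _ card]) auto
  have PI: "y \<in> P" if "adj x u" "adj u y" "y \<noteq> x" "y \<in> N3" for u y
    using that d_2I[of x u y] by (auto simp: P_def)
  have PD: "y \<noteq> x" "y \<in> N3" if "y \<in> P" for y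
    using that d_eq_0[of x x] x' by (auto simp: P_def)
  have "card {y \<in> P. adj y u} = b2 - 1" if "u \<in> U" for u
  proof -
    have "{y \<in> P. adj y u} = {y \<in> N3. adj u y} - {x}"
      using that PI PD adj_sym unfolding U_def by blast
    moreover have "x \<in> {y \<in> N3. adj u y}" using that x adj_sym by (auto simp: U_def)
    ultimately show ?thesis using N2_nbrs(2)[of u] that by (simp add: U_def)
  qed
  then show "(\<Sum>y\<in>P. g x y) = (b2 - 1) * cZ3"
    unfolding g using sum_multicount[OF fin(1,2), of "\<lambda>y u. adj y u"] cU by simp
  have "card {y \<in> P. adj y u} = l - 1" if "u \<in> W" for u
  proof -
    have "{y \<in> P. adj y u} = {y \<in> N3. adj u y} - {x}"
      using that PI PD adj_sym unfolding W_def by blast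
    moreover have "x \<in> {y \<in> N3. adj u y}" using that x adj_sym by (auto simp: W_def)
    ultimately show ?thesis using N4_nbrs(1)[of u] that by (simp add: W_def)
  qed
  then show "(\<Sum>y\<in>P. h x y) = (l - 1) * b3"
    unfolding h using sum_multicount[OF fin(1,3), of "\<lambda>y u. adj y u"] cU by simp
  \<comment> \<open>A common neighbour of a vertex of \<open>N2\<close> and one of \<open>N4\<close> necessarily lies in \<open>N3\<close>.\<close>
  have "card {y \<in> P. adj y (fst p) \<and> adj y (snd p)} = cZ2 - 1" if "p \<in> U \<times> W" for p
  proof -
    obtain u v where p: "p = (u, v)" "u \<in> U" "v \<in> W" using \<open>p \<in> U \<times> W\<close> by auto
    have uv: "u \<in> Z" "v \<in> Z" "u \<noteq> v" "adj x u" "adj x v" "d z v = 4"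
      using p by (auto simp: U_def W_def N2_def N4_def)
    have d: "d u v = 2" using d_2I[of u x v] uv adj_sym by auto
    have comm: "adj y t \<longleftrightarrow> adj t y" for y t using adj_sym by blast
    have "y \<in> P" if "adj u y" "adj v y" "y \<noteq> x" for y
      using PI[OF uv(4) that(1,3) adj_z_dist(2)[OF that(2) uv(6)]] .
    then have "{y \<in> P. adj y u \<and> adj y v} = {y. adj u y \<and> adj v y} - {x}"
      unfolding comm[of _ u] comm[of _ v] using PD(1) by blast
    moreover have "x \<in> {y. adj u y \<and> adj v y}" using uv adj_sym by auto
    ultimately show ?thesis using common_Z[OF uv(1,2) d] p by simp
  qed
  then have "(\<Sum>y\<in>P. card {p \<in> U \<times> W. adj y (fst p) \<and> adj y (snd p)}) = (cZ2 - 1) * card (U \<times> W)"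
    using sum_multicount[of P "U \<times> W" "\<lambda>y p. adj y (fst p) \<and> adj y (snd p)"] fin by simp
  moreover have "{p \<in> U \<times> W. adj y (fst p) \<and> adj y (snd p)} = {u \<in> U. adj y u} \<times> {u \<in> W. adj y u}" for y
    by auto
  ultimately show "(\<Sum>y\<in>P. g x y * h x y) = (cZ2 - 1) * (cZ3 * b3)"
    unfolding g h by (simp add: card_cartesian_product cU)
qed

lemma homogeneous:
  assumes eq: "(real b2 - 1) * (real l - 1) * cY2
      = (real b3 * (real l - 1) + cZ3 * (real b2 - 1)) * (real cZ2 - 1)"
    and x: "x \<in> N3" "y \<in> N3" "d x y = 2"
  shows "real (g x y) * (real b3 * (real l - 1) + cZ3 * (real b2 - 1)) = real cY2 * cZ3 * (real b2 - 1)"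
proof -
  define P where "P = {y \<in> N3. d x y = 2}"
  define A where "A = real cZ3 * (real b2 - 1)"
  define B where "B = real b3 * (real l - 1)"
  define c where "c = real cY2"
  define p where "p = real (card P)"
  define G where "G y = real (g x y)" for y
  have finP: "finite P" using finite_N by (auto simp: P_def)
  note pos = positive_params
  have r: "real (b2 - 1) = real b2 - 1" "real (l - 1) = real l - 1" "real (cZ2 - 1) = real cZ2 - 1"
    using pos by (auto simp: of_nat_diff)
  have H: "real (h x y) = c - G y" if "y \<in> P" for y
    using g_plus_h[OF x(1), of y] that by (auto simp: P_def c_def G_def)
  have sG: "(\<Sum>y\<in>P. G y) = A"
    using arg_cong[OF sums_around(1)[OF x(1)], of real] r by (simp add: P_def G_def A_def)
  have "(\<Sum>y\<in>P. real (h x y)) = B"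
    using arg_cong[OF sums_around(2)[OF x(1)], of real] r by (simp add: P_def B_def)
  then have "(\<Sum>y\<in>P. c - G y) = B" using H by simp
  \<comment> \<open>Adding the sums of \<open>g\<close> and \<open>h\<close> determines the unknown
    size \<open>p\<close> of \<open>P\<close>.\<close>
  then have cp: "c * p = A + B" using sG by (simp add: sum_subtractf p_def algebra_simps)
  have "(\<Sum>y\<in>P. G y * real (h x y)) = (real cZ2 - 1) * (real cZ3 * real b3)"
    using arg_cong[OF sums_around(3)[OF x(1)], of real] r by (simp add: P_def G_def)
  then have "(\<Sum>y\<in>P. G y * (c - G y)) = (real cZ2 - 1) * (real cZ3 * real b3)" using H by simp
  moreover have "(\<Sum>y\<in>P. G y * (c - G y)) = c * A - (\<Sum>y\<in>P. (G y)\<^sup>2)"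
    unfolding sG[symmetric] by (simp add: sum_subtractf sum_distrib_left algebra_simps power2_eq_square)
  ultimately have sG2: "(\<Sum>y\<in>P. (G y)\<^sup>2) = c * A - (real cZ2 - 1) * (real cZ3 * real b3)" by linarith
  have c0: "c > 0" using pos by (simp add: c_def)
  have eq': "(real b2 - 1) * (real l - 1) * c = (A + B) * (real cZ2 - 1)"
    using eq by (simp add: c_def A_def B_def add.commute)
  \<comment> \<open>The factor \<open>c\<close> brings in the left side of the hypothesis; after
    \<open>A + B\<close> is replaced by \<open>c * p\<close> it cancels again.\<close>
  have "c * (A * B) = real cZ3 * real b3 * ((real b2 - 1) * (real l - 1) * c)"
    unfolding A_def B_def by (simp only: mult_ac)
  also have "\<dots> = c * (real cZ3 * real b3 * p * (real cZ2 - 1))"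
    unfolding eq' cp[symmetric] by (simp only: mult_ac)
  finally have AB: "A * B = real cZ3 * real b3 * p * (real cZ2 - 1)" using c0 by simp
  have "p * (\<Sum>y\<in>P. (G y)\<^sup>2) = (c * p) * A - real cZ3 * real b3 * p * (real cZ2 - 1)"
    unfolding sG2 by (subst right_diff_distrib) (simp only: mult_ac)
  also have "\<dots> = A\<^sup>2" unfolding cp AB[symmetric] by (simp add: algebra_simps power2_eq_square)
  finally have CS: "p * (\<Sum>y\<in>P. (G y)\<^sup>2) = A\<^sup>2" .
  \<comment> \<open>The hypothesis is the equality case of Cauchy--Schwarz.\<close>
  have "(\<Sum>y\<in>P. (p * G y - A)\<^sup>2) = p * (p * (\<Sum>y\<in>P. (G y)\<^sup>2)) - 2 * p * A * (\<Sum>y\<in>P. G y) + p * A\<^sup>2"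
    (is "_ = ?R")
  proof -
    have "(\<Sum>y\<in>P. (p * G y - A)\<^sup>2) = (\<Sum>y\<in>P. p * p * (G y)\<^sup>2 - 2 * p * A * G y + A\<^sup>2)"
      by (rule sum.cong) (auto simp: power2_eq_square algebra_simps)
    also have "\<dots> = p * p * (\<Sum>y\<in>P. (G y)\<^sup>2) - 2 * p * A * (\<Sum>y\<in>P. G y) + p * A\<^sup>2"
      by (simp add: sum.distrib sum_subtractf sum_distrib_left p_def)
    finally show ?thesis by (simp add: mult.assoc)
  qed
  also have "\<dots> = 0" unfolding CS sG by (simp add: algebra_simps power2_eq_square)
  finally have "\<forall>y\<in>P. (p * G y - A)\<^sup>2 = 0"
    using sum_nonneg_eq_0_iff[OF finP, of "\<lambda>y. (p * G y - A)\<^sup>2"] by simp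
  moreover have "y \<in> P" using x by (simp add: P_def)
  ultimately have "p * G y = A" by simp
  \<comment> \<open>Multiplying by \<open>c\<close> turns the mean value \<open>A / p\<close> into
    \<open>c * A / (A + B)\<close>, which is gamma_3.\<close>
  then have "G y * (c * p) = c * A" by (simp add: algebra_simps)
  then show ?thesis unfolding cp by (simp add: A_def B_def c_def G_def add.commute mult.assoc)
qed

text \<open>Both products count the paths of length 3 between \<open>z\<close> and a vertex
  \<open>x\<close> of \<open>N3\<close>, sorted by the inner vertex next to \<open>z\<close> or by
  the one next to \<open>x\<close>.\<close>

lemma degree_identity: "cY2 * cY3 = cZ2 * cZ3"
proof -
  obtain x where x: "x \<in> N3" using N4_nonempty N4_down by blast
  then have xY: "x \<in> Y" "x \<in> Y \<union> Z" "d z x = 3" by (auto simp: N3_def)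
  define Q where "Q = {u \<in> N2. adj x u}"
  define R where "R = {y. adj z y \<and> d x y = 2}"
  have fin: "finite Q" "finite R" using finite_N finite_nbrs by (auto simp: Q_def R_def)
  have dxz: "d x z = 3" using d_sym[OF zV xY(2)] xY(3) by simp
  have cR: "card R = cY3" unfolding R_def using cY3[OF xY(1) z dxz] .
  have cQ: "card Q = cZ3" unfolding Q_def using N3_nbrs(1)[OF x] .
  have 1: "card {y \<in> R. adj u y} = cZ2" if "u \<in> Q" for u
  proof -
    have u: "u \<in> Z" "d z u = 2" "adj x u" using that by (auto simp: Q_def N2_def)
    have "d x y = 2" if "adj z y" "adj u y" for y
    proof -
      have "d z y = 1" using that d_1 zV adj_verts by blast
      then have "x \<noteq> y" using xY by auto
      then show ?thesis using d_2I[OF u(3) that(2)] by blast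
    qed
    then have "{y \<in> R. adj u y} = {y. adj z y \<and> adj u y}" unfolding R_def by blast
    then show ?thesis using common_Z[OF z u(1,2)] by simp
  qed
  have 2: "card {u \<in> Q. adj u y} = cY2" if "y \<in> R" for y
  proof -
    have y: "adj z y" "d x y = 2" using that by (auto simp: R_def)
    have yY: "y \<in> Y" using adj_parts[OF y(1)] z disj by auto
    have "u \<in> N2" if "adj x u" "adj y u" for u
    proof -
      have uZ: "u \<in> Z" using adj_parts[OF that(1)] xY disj by auto
      have "u \<noteq> z" using that(1) dxz d_1[of x z] xY zV by auto
      then show ?thesis using d_2I[OF y(1) that(2)] uZ by (auto simp: N2_def)
    qed
    then have "{u \<in> Q. adj u y} = {u. adj x u \<and> adj y u}" unfolding Q_def using adj_sym by blast
    then show ?thesis using common_Y[OF xY(1) yY y(2)] by simp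
  qed
  have "(\<Sum>u\<in>Q. card {y \<in> R. adj u y}) = cY2 * card R"
    using 2 by (intro sum_multicount fin) blast
  then show ?thesis using 1 cR cQ by (simp add: mult.commute)
qed

text \<open>Edges between consecutive spheres around \<open>z\<close> are counted from both ends;
  the witness \<open>n2\<close> is the size of \<open>N2\<close>.\<close>

lemma sphere_counts:
  "\<exists>n2. l * (k - 1) = n2 * cZ2 \<and> n2 * b2 = card N3 * cZ3" "card N3 * b3 = card N4 * l"
proof -
  define N1 where "N1 = {y. adj z y}"
  have fin1: "finite N1" unfolding N1_def using finite_nbrs[of z "\<lambda>_. True"] by simp
  have c1: "card N1 = l" unfolding N1_def using deg_Z[OF z] .
  have 1: "card {u \<in> N2. adj y u} = k - 1" if "y \<in> N1" for y
  proof -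
    have y: "adj z y" "y \<in> Y" using that adj_parts z disj unfolding N1_def by blast+
    have "u \<in> N2" if "adj y u" "u \<noteq> z" for u
      using d_2I[OF y(1) that(1)] that adj_parts[OF that(1)] y disj by (auto simp: N2_def)
    moreover have "z \<notin> N2" using d_eq_0[OF zV zV] by (auto simp: N2_def)
    ultimately have "{u \<in> N2. adj y u} = {u. adj y u} - {z}" by blast
    moreover have "z \<in> {u. adj y u}" using y adj_sym by auto
    ultimately show ?thesis using deg_Y[OF y(2)] by simp
  qed
  have 2: "card {y \<in> N1. adj y u} = cZ2" if "u \<in> N2" for u
  proof -
    have u: "u \<in> Z" "d z u = 2" using that by (auto simp: N2_def)
    have "{y \<in> N1. adj y u} = {y. adj z y \<and> adj u y}" unfolding N1_def using adj_sym by blast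
    then show ?thesis using common_Z[OF z u] by simp
  qed
  have "(\<Sum>y\<in>N1. card {u \<in> N2. adj y u}) = cZ2 * card N2"
    using 2 by (intro sum_multicount fin1 finite_N) blast
  then have a: "l * (k - 1) = card N2 * cZ2" using 1 c1 by (simp add: mult.commute)
  have "{u \<in> N2. adj u y} = {u \<in> N2. adj y u}" for y using adj_sym by blast
  then have "(\<Sum>u\<in>N2. card {y \<in> N3. adj u y}) = cZ3 * card N3"
    using N3_nbrs(1) by (intro sum_multicount finite_N) auto
  then have b: "card N2 * b2 = card N3 * cZ3" using N2_nbrs(2) by (simp add: mult.commute)
  show "\<exists>n2. l * (k - 1) = n2 * cZ2 \<and> n2 * b2 = card N3 * cZ3" using a b by blast
  have "{y \<in> N3. adj y u} = {y \<in> N3. adj u y}" for u using adj_sym by blast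
  then have "(\<Sum>y\<in>N3. card {u \<in> N4. adj y u}) = l * card N4"
    using N4_nbrs(1) by (intro sum_multicount finite_N) auto
  then show "card N3 * b3 = card N4 * l" using N3_nbrs(2) by (simp add: mult.commute)
qed

end

section \<open>The induced subgraph\<close>

text \<open>The outcome of the Cauchy-Schwarz argument in natural numbers: \<open>gam\<close> and
  \<open>del\<close> are integers, being values of \<open>g\<close> and \<open>h\<close>. The
  equations \<open>extremal\<close> and \<open>gam_eq\<close> feed the arithmetic of
  \<open>no_extremal_parameters\<close>.\<close>

locale homogeneous_four = biregular_four +
  fixes gam del :: nat
  assumes hom: "x \<in> N3 \<Longrightarrow> y \<in> N3 \<Longrightarrow> d x y = 2 \<Longrightarrow> card {u \<in> N4. adj x u \<and> adj y u} = del"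
    and gam_del: "gam + del = cY2" and del_pos: "0 < del" and del_less: "del < b3"
    and extremal: "(real b2 - 1) * (real l - 1) * cY2
      = (real b3 * (real l - 1) + cZ3 * (real b2 - 1)) * (real cZ2 - 1)"
    and gam_eq: "real gam * (real b3 * (real l - 1) + cZ3 * (real b2 - 1)) = real cY2 * cZ3 * (real b2 - 1)"
begin

abbreviation "S \<equiv> N3 \<union> N4"

lemma S_verts: "a \<in> S \<Longrightarrow> a \<in> Y \<union> Z" "a \<in> N3 \<Longrightarrow> a \<in> Y" "a \<in> N4 \<Longrightarrow> a \<in> Z"
    "a \<in> N3 \<Longrightarrow> a \<in> Y \<union> Z" "a \<in> N4 \<Longrightarrow> a \<in> Y \<union> Z"
  by (auto simp: N3_def N4_def)

lemma S_dist:
  shows "a \<in> N3 \<Longrightarrow> w \<in> N3 \<Longrightarrow> d a w \<in> {0, 2, 4}"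
    and "a \<in> N4 \<Longrightarrow> w \<in> N4 \<Longrightarrow> d a w \<in> {0, 2, 4}"
    and "a \<in> N3 \<Longrightarrow> w \<in> N4 \<Longrightarrow> d a w \<in> {1, 3}"
    and "a \<in> N4 \<Longrightarrow> w \<in> N3 \<Longrightarrow> d a w \<in> {1, 3}"
proof -
  have e: "d a w \<in> {0, 2, 4}" if "d a w \<le> 4" "even (d a w)" for a w
  proof -
    have "d a w \<in> {0,1,2,3,4}" using that(1) by auto
    then show ?thesis using that(2) by auto
  qed
  have o: "d a w \<in> {1, 3}" if "d a w \<le> 4" "odd (d a w)" for a w
  proof -
    have "d a w \<in> {0,1,2,3,4}" using that(1) by auto
    then show ?thesis using that(2) by auto
  qed
  show "d a w \<in> {0, 2, 4}" if "a \<in> N3" "w \<in> N3"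
    using parity[of a w] d_le[of a w] S_verts that disj by (intro e) auto
  show "d a w \<in> {0, 2, 4}" if "a \<in> N4" "w \<in> N4"
    using parity[of a w] d_le[of a w] S_verts that disj by (intro e) auto
  show "d a w \<in> {1, 3}" if "a \<in> N3" "w \<in> N4"
    using parity[of a w] d_le[of a w] S_verts that disj by (intro o) auto
  show "d a w \<in> {1, 3}" if "a \<in> N4" "w \<in> N3"
    using parity[of a w] d_le[of a w] S_verts that disj by (intro o) auto
qed

lemma adj_S: "adj u w \<Longrightarrow> u \<in> N3 \<Longrightarrow> w \<in> S \<Longrightarrow> w \<in> N4" "adj u w \<Longrightarrow> u \<in> N4 \<Longrightarrow> w \<in> N3"
  subgoal using adj_parts[of u w] disj by (auto simp: N3_def N4_def)
  subgoal using N4_nbrs(2) by blast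
  done

lemma common_N4:
  assumes "x \<in> N3" "y \<in> N3" "d x y = 2"
  obtains u where "u \<in> N4" "adj x u" "adj y u"
proof -
  have "card {u \<in> N4. adj x u \<and> adj y u} \<noteq> 0" using hom[OF assms] del_pos by simp
  then have "{u \<in> N4. adj x u \<and> adj y u} \<noteq> {}" by (metis card.empty)
  then show ?thesis using that by blast
qed

lemma N3_up:
  assumes "x \<in> N3"
  obtains u where "u \<in> N4" "adj x u"
proof -
  have "card {u \<in> N4. adj x u} \<noteq> 0" using N3_nbrs(2)[OF assms] del_less by simp
  then have "{u \<in> N4. adj x u} \<noteq> {}" by (metis card.empty)
  then show ?thesis using that by blast
qed

text \<open>A predecessor of a vertex of \<open>N4\<close> lies in \<open>N3\<close> anyway. For
  \<open>w\<close> in \<open>N3\<close> it is to be chosen in \<open>N4\<close>: at distance 2 from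
  \<open>a\<close> it exists because \<open>del > 0\<close>; at distance 4 any neighbour in
  \<open>N4\<close> works; at distance 3 it is a common neighbour of \<open>w\<close> and a
  neighbour \<open>y\<close> of \<open>a\<close> with \<open>d w y = 2\<close>.\<close>

lemma isometric:
  assumes a: "a \<in> S" and w: "w \<in> S" and n: "d a w = Suc n"
  shows "\<exists>u \<in> S. adj w u \<and> d a u = n"
proof -
  have aV: "a \<in> Y \<union> Z" and wV: "w \<in> Y \<union> Z" using a w S_verts by blast+
  consider "w \<in> N4" | "w \<in> N3" "a \<in> N3" | "w \<in> N3" "a \<in> N4" using a w by blast
  then show ?thesis
  proof cases
    case 1
    then show ?thesis using d_pred[OF aV wV n] N4_nbrs(2) by blast
  next
    case 2
    then have "d a w = 2 \<or> d a w = 4" using S_dist(1)[of a w] n by auto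
    then show ?thesis
    proof
      assume "d a w = 2"
      then obtain u where u: "u \<in> N4" "adj a u" "adj w u" using common_N4[OF 2(2,1)] by blast
      have "d a u = 1" using u d_1[OF aV] adj_verts by blast
      then show ?thesis using u n \<open>d a w = 2\<close> by auto
    next
      assume d4: "d a w = 4"
      obtain u where u: "u \<in> N4" "adj w u" using N3_up[OF 2(1)] by blast
      have "d a u = 3" using d_adj[OF aV u(2)] S_dist(3)[OF 2(2) u(1)] d4 by auto
      then show ?thesis using u n d4 by auto
    qed
  next
    case 3
    then have "d a w = 1 \<or> d a w = 3" using S_dist(4)[of a w] by auto
    then show ?thesis
    proof
      assume "d a w = 1"
      moreover then have "adj w a" using d_1[OF aV wV] adj_sym by blast
      ultimately show ?thesis using a n d_eq_0[OF aV aV] by auto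
    next
      assume d3: "d a w = 3"
      then have "d w a = Suc 2" using d_sym[OF aV wV] by simp
      then obtain y where y: "adj a y" "d w y = 2" using d_pred[OF wV aV] by blast
      have yN: "y \<in> N3" using N4_nbrs(2)[OF 3(2) y(1)] .
      obtain u where u: "u \<in> N4" "adj w u" "adj y u" using common_N4[OF 3(1) yN y(2)] .
      have "a \<noteq> u" using d_1[OF wV, of u] u \<open>d w a = Suc 2\<close> adj_verts by fastforce
      then have "d a u = 2" using d_2I[OF y(1) u(3)] by blast
      then show ?thesis using u n d3 by auto
    qed
  qed
qed

section \<open>Intersection numbers and eccentricities of the induced subgraph\<close>

lemma S_degree:
  shows "a \<in> N3 \<Longrightarrow> card {u \<in> S. adj a u} = b3"
    and "a \<in> N4 \<Longrightarrow> card {u \<in> S. adj a u} = l"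
proof -
  assume a: "a \<in> N3"
  have "{u \<in> S. adj a u} = {u \<in> N4. adj a u}" using adj_S a by blast
  then show "card {u \<in> S. adj a u} = b3" using N3_nbrs(2)[OF a] by simp
next
  assume a: "a \<in> N4"
  have "{u \<in> S. adj a u} = {u \<in> N3. adj a u}" using adj_S a by blast
  then show "card {u \<in> S. adj a u} = l" using N4_nbrs(1)[OF a] by simp
qed

lemma S_c1:
  assumes "a \<in> S" "w \<in> S" "d a w = 1"
  shows "card {u \<in> S. adj w u \<and> d a u = 0} = 1"
proof -
  have "a \<in> Y \<union> Z" "w \<in> Y \<union> Z" using assms S_verts by blast+
  moreover then have "adj w a" using d_1 adj_sym assms by blast
  moreover have "d a u = 0 \<longleftrightarrow> u = a" if "u \<in> S" for u
    using d_eq_0[OF S_verts(1)[OF assms(1)] S_verts(1)[OF that]] by auto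
  ultimately have "u \<in> {u \<in> S. adj w u \<and> d a u = 0} \<longleftrightarrow> u \<in> {a}" for u
    using assms(1) by (cases "u = a") auto
  then have "{u \<in> S. adj w u \<and> d a u = 0} = {a}" by (rule set_eqI)
  then show ?thesis by simp
qed

lemma S_c2_N3:
  assumes "a \<in> N3" "w \<in> N3" "d a w = 2"
  shows "card {u \<in> S. adj w u \<and> d a u = 1} = del"
proof -
  have "d a u = 1 \<longleftrightarrow> adj a u" if "u \<in> S" for u using d_1[of a u] assms that S_verts by blast
  then have "{u \<in> S. adj w u \<and> d a u = 1} = {u \<in> N4. adj a u \<and> adj w u}"
    using adj_S(1) assms by blast
  then show ?thesis using hom[OF assms] by simp
qed

lemma S_c3_N3:
  assumes "a \<in> N3" "w \<in> N4" "d a w = 3"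
  shows "card {u \<in> S. adj w u \<and> d a u = 2} = cY3"
proof -
  have "{u \<in> S. adj w u \<and> d a u = 2} = {u. adj w u \<and> d a u = 2}"
    using adj_S(2) assms by blast
  then show ?thesis using cY3[of a w] assms S_verts by simp
qed

lemma S_c4_N3:
  assumes "a \<in> N3" "w \<in> N3" "d a w = 4"
  shows "card {u \<in> S. adj w u \<and> d a u = 3} = b3"
proof -
  have "d a u = 3" if "u \<in> N4" "adj w u" for u
    using d_adj[of a w u] S_dist(3)[OF assms(1) that(1)] assms that S_verts by auto
  then have "{u \<in> S. adj w u \<and> d a u = 3} = {u \<in> N4. adj w u}"
    using adj_S(1) assms by blast
  then show ?thesis using N3_nbrs(2)[OF assms(2)] by simp
qed

lemma S_c2_N4:
  assumes "a \<in> N4" "w \<in> N4" "d a w = 2"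
  shows "card {u \<in> S. adj w u \<and> d a u = 1} = cZ2"
proof -
  have "{u \<in> S. adj w u \<and> d a u = 1} = {u. adj w u \<and> d a u = 1}"
    using adj_S(2) assms by blast
  then show ?thesis using cZ2[of a w] assms S_verts by simp
qed

lemma S_c4_N4:
  assumes "a \<in> N4" "w \<in> N4" "d a w = 4"
  shows "card {u \<in> S. adj w u \<and> d a u = 3} = l"
proof -
  have "d a u = 3" if "u \<in> N3" "adj w u" for u
    using d_adj[of a w u] S_dist(4)[OF assms(1) that(1)] assms that S_verts by auto
  then have "{u \<in> S. adj w u \<and> d a u = 3} = {u \<in> N3. adj w u}"
    using adj_S(2) assms by blast
  then show ?thesis using N4_nbrs(1)[OF assms(2)] by simp
qed

text \<open>Both sides count the paths of length \<open>3\<close> from \<open>x\<close> to \<open>a\<close> inside \<open>N3 \<union> N4\<close>.\<close>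

lemma S_c3_N4:
  assumes "a \<in> N4" "x \<in> N3" "d a x = 3"
  shows "card {u \<in> S. adj x u \<and> d a u = 2} * cZ2 = del * cY3"
proof -
  have aV: "a \<in> Y \<union> Z" "a \<in> Z" and xV: "x \<in> Y \<union> Z" "x \<in> Y" using assms S_verts by blast+
  define Q where "Q = {u \<in> S. adj x u \<and> d a u = 2}"
  define R where "R = {y. adj a y \<and> d x y = 2}"
  have fin: "finite Q" "finite R" using finite_N finite_nbrs by (auto simp: Q_def R_def)
  have dxa: "d x a = 3" using d_sym[OF aV(1) xV(1)] assms(3) by simp
  have cR: "card R = cY3" unfolding R_def using cY3[OF xV(2) aV(2) dxa] .
  have 1: "card {y \<in> R. adj u y} = cZ2" if "u \<in> Q" for u
  proof -
    have u: "u \<in> N4" "u \<in> Z" "d a u = 2" "adj x u"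
      using that adj_S(1) assms(2) S_verts unfolding Q_def by blast+
    have "d x y = 2" if "adj a y" "adj u y" for y
    proof -
      have "d a y = 1" using that d_1 aV adj_verts by blast
      then have "x \<noteq> y" using assms by auto
      then show ?thesis using d_2I[OF u(4) that(2)] by blast
    qed
    then have "{y \<in> R. adj u y} = {y. adj a y \<and> adj u y}" unfolding R_def by blast
    then show ?thesis using common_Z[OF aV(2) u(2,3)] by simp
  qed
  have 2: "card {u \<in> Q. adj u y} = del" if "y \<in> R" for y
  proof -
    have y: "adj a y" "d x y = 2" using that by (auto simp: R_def)
    have yN: "y \<in> N3" using N4_nbrs(2)[OF assms(1) y(1)] .
    have "d a u = 2" if "adj x u" "adj y u" for u
    proof -
      have "u \<noteq> a" using that(1) dxa d_1[of x a] xV aV by auto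
      then show ?thesis using d_2I[OF y(1) that(2)] by auto
    qed
    then have "{u \<in> Q. adj u y} = {u \<in> N4. adj x u \<and> adj y u}"
      unfolding Q_def using adj_sym adj_S(1) assms(2) by blast
    then show ?thesis using hom[OF assms(2) yN y(2)] by simp
  qed
  have "(\<Sum>u\<in>Q. card {y \<in> R. adj u y}) = del * card R"
    using 2 by (intro sum_multicount fin) blast
  then show ?thesis using 1 cR by (simp add: Q_def)
qed

text \<open>A geodesic \<open>x\<close>, \<open>v\<close>, \<open>y\<close>, \<open>w\<close>,
  \<open>t\<close> is built step by step: \<open>y\<close> exists since \<open>l \<ge> 2\<close>,
  then \<open>w\<close> since only \<open>del < b3\<close> of the neighbours of \<open>y\<close> in
  \<open>N4\<close> are adjacent to \<open>x\<close>, and \<open>t\<close> since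
  \<open>cY3 < l\<close>.\<close>

lemma S_ecc_N3:
  assumes "x \<in> N3"
  shows "\<exists>w \<in> N3. d x w = 4"
proof -
  have xV: "x \<in> Y \<union> Z" "x \<in> Y" using assms S_verts by blast+
  obtain v where v: "v \<in> N4" "adj x v" using N3_up[OF assms] .
  have "{y \<in> N3. adj v y} \<noteq> {x}" using N4_nbrs(1)[OF v(1)] positive_params(5) by auto
  moreover have "x \<in> {y \<in> N3. adj v y}" using v assms adj_sym by auto
  ultimately obtain y where y: "y \<in> N3" "adj v y" "x \<noteq> y" by blast
  have d2: "d x y = 2" using d_2I[OF v(2) y(2,3)] .
  have "{u \<in> N4. adj x u \<and> adj y u} \<noteq> {u \<in> N4. adj y u}"
    using hom[OF assms y(1) d2] N3_nbrs(2)[OF y(1)] del_less by auto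
  then obtain w where w: "w \<in> N4" "adj y w" "\<not> adj x w" by blast
  have "d x w = 3"
    using S_dist(3)[OF assms w(1)] d_1[OF xV(1), of w] w S_verts by auto
  have wZ: "w \<in> Z" using w S_verts by blast
  have "{u. adj w u \<and> d x u = 2} \<noteq> {u. adj w u}"
    using cY3[OF xV(2) wZ \<open>d x w = 3\<close>] deg_Z[OF wZ] positive_params(8) by auto
  then obtain t where t: "adj w t" "d x t \<noteq> 2" by blast
  have "t \<in> N3" using N4_nbrs(2)[OF w(1) t(1)] .
  moreover have "d x t = 4" using d_adj[OF xV(1) t(1)] t \<open>d x w = 3\<close> by auto
  ultimately show ?thesis by blast
qed

text \<open>Otherwise all other vertices of \<open>N4\<close> are at distance 2 from
  \<open>a\<close>. This adds the relations \<open>i\<close> and \<open>ii\<close> to the known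
  ones, and \<open>no_extremal_parameters\<close> refutes the whole system.\<close>

lemma S_ecc_N4:
  assumes a: "a \<in> N4"
  shows "\<exists>w \<in> N4. d a w = 4"
proof (rule ccontr)
  assume none: "\<not> ?thesis"
  have aV: "a \<in> Y \<union> Z" "a \<in> Z" using a S_verts by blast+
  have near: "d a w = 2" if "w \<in> N4" "w \<noteq> a" for w
    using S_dist(2)[OF a that(1)] none d_eq_0[OF aV(1), of w] that S_verts by auto
  obtain y where y: "y \<in> N3" "adj a y" using N4_down[OF a] by blast
  \<comment> \<open>A vertex at distance 4 from a neighbour of \<open>a\<close> is at distance 3
    from \<open>a\<close>, so \<open>S_c3_N4\<close> applies to it.\<close>
  obtain t where t: "t \<in> N3" "d y t = 4" using S_ecc_N3[OF y(1)] by blast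
  have tV: "t \<in> Y \<union> Z" "y \<in> Y \<union> Z" using t y S_verts by blast+
  have "d t a = 3" using d_adj[OF tV(1) y(2)] d_sym[OF tV] d_le[OF tV(1) aV(1)] t by auto
  then have da: "d a t = 3" using d_sym[OF tV(1) aV(1)] by simp
  have "d a u = 2" if "u \<in> N4" "adj t u" for u
    using near[OF that(1)] that \<open>d t a = 3\<close> d_1[OF tV(1), of u] S_verts(5) by fastforce
  then have "{u \<in> S. adj t u \<and> d a u = 2} = {u \<in> N4. adj t u}" using adj_S(1) t(1) by blast
  \<comment> \<open>All \<open>b3\<close> neighbours of \<open>t\<close> in \<open>N4\<close> are at
    distance 2 from \<open>a\<close>, so the third intersection number must be
    \<open>b3\<close>.\<close>
  then have i: "b3 * cZ2 = del * cY3" using S_c3_N4[OF a t(1) da] N3_nbrs(2)[OF t(1)] by simp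
  define W where "W = N4 - {a}"
  define R where "R = {y. adj a y}"
  have fin: "finite W" "finite R" using finite_N finite_nbrs[of a "\<lambda>_. True"] by (auto simp: W_def R_def)
  have cW: "card W = card N4 - 1" using a by (simp add: W_def)
  have N4pos: "card N4 \<ge> 1" using a finite_N(3) by (metis One_nat_def Suc_leI card_gt_0_iff empty_iff)
  have 1: "card {y \<in> R. adj u y} = cZ2" if "u \<in> W" for u
  proof -
    have "u \<in> Z" "d a u = 2" using that near S_verts by (auto simp: W_def)
    moreover have "{y \<in> R. adj u y} = {y. adj a y \<and> adj u y}" by (auto simp: R_def)
    ultimately show ?thesis using common_Z[OF aV(2)] by simp
  qed
  have 2: "card {u \<in> W. adj u y} = b3 - 1" if "y \<in> R" for y
  proof -
    have yN: "y \<in> N3" using that N4_nbrs(2)[OF a] by (auto simp: R_def)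
    have "{u \<in> W. adj u y} = {u \<in> N4. adj y u} - {a}" unfolding W_def using adj_sym by blast
    moreover have "a \<in> {u \<in> N4. adj y u}" using that a adj_sym by (auto simp: R_def)
    ultimately show ?thesis using N3_nbrs(2)[OF yN] by simp
  qed
  \<comment> \<open>Edges between \<open>N4 - {a}\<close> and the neighbours of \<open>a\<close>,
    counted from both sides.\<close>
  have "(\<Sum>u\<in>W. card {y \<in> R. adj u y}) = (b3 - 1) * card R"
    using 2 by (intro sum_multicount fin) blast
  then have ii: "(card N4 - 1) * cZ2 = l * (b3 - 1)"
    using 1 cW deg_Z[OF aV(2)] by (simp add: R_def mult.commute)
  obtain n2 where n2: "l * (k - 1) = n2 * cZ2" "n2 * b2 = card N3 * cZ3" using sphere_counts(1) by blast
  note pos = positive_params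
  have k1: "k \<ge> 1" using pos by linarith
  \<comment> \<open>Passing to integers makes \<open>b2 - 1\<close> and \<open>b3 - 1\<close>
    untruncated; the real equations transfer because all their terms are integral.\<close>
  define B2 where "B2 = int b2"
  define B3 where "B3 = int b3"
  have rB: "real b2 = real_of_int B2" "real b3 = real_of_int B3" by (simp_all add: B2_def B3_def)
  have "real_of_int ((B2 - 1) * (int l - 1) * int cY2)
      = real_of_int ((B3 * (int l - 1) + int cZ3 * (B2 - 1)) * (int cZ2 - 1))"
    using extremal unfolding rB by simp
  then have v: "(B2 - 1) * (int l - 1) * int cY2 = (B3 * (int l - 1) + int cZ3 * (B2 - 1)) * (int cZ2 - 1)"
    by (simp only: of_int_eq_iff)
  have "real_of_int (int gam * (B3 * (int l - 1) + int cZ3 * (B2 - 1)))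
      = real_of_int (int cY2 * int cZ3 * (B2 - 1))"
    using gam_eq unfolding rB by simp
  then have vi: "int gam * (B3 * (int l - 1) + int cZ3 * (B2 - 1)) = int cY2 * int cZ3 * (B2 - 1)"
    by (simp only: of_int_eq_iff)
  show False
  proof (rule no_extremal_parameters[OF _ _ _ _ _ _ _ _ _ _ _ _ _ _ _ _ _ _ v vi])
    show "1 \<le> int cZ2" "1 \<le> int cZ3" "1 \<le> B2" "1 \<le> int cY3" "int cY3 < int l" "1 \<le> int cY2"
      "0 \<le> int gam" "0 < int del" "int del < B3"
      using pos del_pos del_less unfolding B2_def B3_def by linarith+
    show "int l = int cZ2 + B2" "int k = int cZ3 + B3" using pos by (simp_all add: B2_def B3_def)
    show "int cY2 = int gam + int del" using gam_del by linarith
    show "B3 * int cZ2 = int del * int cY3" using arg_cong[OF i, of int] by (simp add: B3_def)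
    have "int (card N4 - 1) = int (card N4) - 1" "int (b3 - 1) = B3 - 1"
      using N4pos pos by (simp_all add: B3_def of_nat_diff)
    then show "(int (card N4) - 1) * int cZ2 = int l * (B3 - 1)"
      using arg_cong[OF ii, of int] by (simp only: of_nat_mult)
    have "int (k - 1) = int k - 1" using k1 by (simp add: of_nat_diff)
    then show "int l * (int k - 1) = int n2 * int cZ2" using arg_cong[OF n2(1), of int] by (simp only: of_nat_mult)
    show "int n2 * B2 = int (card N3) * int cZ3" "int (card N3) * B3 = int (card N4) * int l"
      using arg_cong[OF n2(2), of int] arg_cong[OF sphere_counts(2), of int]
      by (simp_all only: of_nat_mult B2_def B3_def)
    show "int cY2 * int cY3 = int cZ2 * int cZ3"
      using arg_cong[OF degree_identity, of int] by (simp only: of_nat_mult)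
  qed
qed

end

section \<open>Transfer to the graph \<open>G\<close> and assembly of the two rows\<close>

theorem theorem6p1:
  fixes G :: "('a, 'b) pre_digraph" and Y Z :: "'a set"
    and k l cY1 cY2 cY3 cY4 cZ1 cZ2 cZ3 cZ4 bZ2 bZ3 \<gamma>3 :: real
  assumes dbr: "distance_biregular G Y Z"
    and arr: "intersection_array G Y Z (k, [cY1, cY2, cY3, cY4]) (l, [cZ1, cZ2, cZ3, cZ4])"
    and bZ2: "bZ2 = l - cZ2"
    and bZ3: "bZ3 = k - cZ3"
    and eq: "(bZ2 - 1) * (cZ4 - 1) - (bZ3 * (cZ4 - 1) + cZ3 * (bZ2 - 1)) / cY2 * (cZ2 - 1) = 0"
    and gamma: "\<gamma>3 = (cY2 * cZ3 * (bZ2 - 1)) / (bZ3 * (cZ4 - 1) + cZ3 * (bZ2 - 1))"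
    and "cY2 > \<gamma>3"
    and "bZ3 > cY2 - \<gamma>3"
  shows "\<forall>z\<in>Z. nbhd G 3 z \<subseteq> Y \<and> nbhd G 4 z \<subseteq> Z \<and>
    distance_biregular (G \<restriction> (nbhd G 3 z \<union> nbhd G 4 z)) (nbhd G 3 z) (nbhd G 4 z) \<and>
    intersection_array (G \<restriction> (nbhd G 3 z \<union> nbhd G 4 z)) (nbhd G 3 z) (nbhd G 4 z)
      (bZ3, [1, cY2 - \<gamma>3, cY3, bZ3])
      (l, [1, cZ2, (cY2 - \<gamma>3) * cY3 / cZ2, l])"
proof
  fix z assume z: "z \<in> Z"
  have bip: "bipartite_graph G Y Z" using dbr by (simp add: distance_biregular_def)
  then have bip': "bipartite_graph G Z Y" by (auto simp: bipartite_graph_def)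
  interpret graph G using bip by (simp add: bipartite_graph_def)
  have V: "verts G = Y \<union> Z" and disj: "Y \<inter> Z = {}"
    and parts: "\<And>u v. u \<rightarrow>\<^bsub>G\<^esub> v \<Longrightarrow> u \<in> Y \<and> v \<in> Z \<or> u \<in> Z \<and> v \<in> Y"
    using bip by (auto simp: bipartite_graph_def)
  have rowY: "array_row G Y (k, [cY1, cY2, cY3, cY4])" and rowZ: "array_row G Z (l, [cZ1, cZ2, cZ3, cZ4])"
    using arr by (simp_all add: intersection_array_def)
  have sym: "u \<rightarrow>\<^bsub>G\<^esub> v \<Longrightarrow> v \<rightarrow>\<^bsub>G\<^esub> u" for u v
    using arcs_ends_symmetric[OF sym_arcs] .
  have nd: "gdist G a w = ereal (real (ndist G a w))" "ndist G a w \<le> 4"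
    if "a \<in> Y \<union> Z" "w \<in> Y \<union> Z" for a w
    using gdist_eq_ndist[OF bip rowY, of a w] gdist_eq_ndist[OF bip' rowZ, of a w] that V by auto
  \<comment> \<open>Integrality of the entries in the first row needs a vertex of \<open>Y\<close>;
    a neighbour of \<open>z\<close> serves.\<close>
  obtain y where "y \<in> verts G" "ndist G z y = 1" using ex_ndist[OF bip' rowZ z, of 1] by auto
  then have "gdist G z y = ereal (real 1)" using gdist_eq_ndist(1)[OF bip' rowZ z] by metis
  then have y: "y \<in> Y" using bipartite_gdist_parity[OF bip' z] by (metis odd_one)
  note entY = array_row_entry_nat[OF bip rowY y] and entZ = array_row_entry_nat[OF bip' rowZ z]
  obtain nY2 where nY2: "cY2 = real nY2" using entY[of 1] by auto
  obtain nY3 where nY3: "cY3 = real nY3" using entY[of 2] by auto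
  obtain nZ2 where nZ2: "cZ2 = real nZ2" using entZ[of 1] by auto
  obtain nZ3 where nZ3: "cZ3 = real nZ3" using entZ[of 2] by auto
  have degY: "real (card {u. a \<rightarrow>\<^bsub>G\<^esub> u}) = k" if "a \<in> Y" for a
    using rowY that by (auto simp: array_row_def out_degree_eq_card)
  have degZ: "real (card {u. a \<rightarrow>\<^bsub>G\<^esub> u}) = l" if "a \<in> Z" for a
    using rowZ that by (auto simp: array_row_def out_degree_eq_card)
  obtain nk where nk: "k = real nk" using degY[OF y] by metis
  obtain nl where nl: "l = real nl" using degZ[OF z] by metis
  interpret B: biregular_four "\<lambda>u v. u \<rightarrow>\<^bsub>G\<^esub> v" "ndist G" Y Z nk nl nY2 nY3 nZ2 nZ3 z
  proof
    show "finite Y" "finite Z" using finite_verts unfolding V by simp_all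
    show "Y \<inter> Z = {}" "z \<in> Z" by fact+
    show "u \<rightarrow>\<^bsub>G\<^esub> v \<Longrightarrow> v \<rightarrow>\<^bsub>G\<^esub> u" for u v by (rule sym)
    show "u \<rightarrow>\<^bsub>G\<^esub> v \<Longrightarrow> u \<in> Y \<and> v \<in> Z \<or> u \<in> Z \<and> v \<in> Y" for u v by (rule parts)
    show "a \<in> Y \<union> Z \<Longrightarrow> w \<in> Y \<union> Z \<Longrightarrow> ndist G a w \<le> 4" for a w by (rule nd)
    show "ndist G a w = ndist G w a" for a w unfolding ndist_def gdist_sym[of a w] ..
    show "ndist G a w = 0 \<longleftrightarrow> a = w" if "a \<in> Y \<union> Z" "w \<in> Y \<union> Z" for a w
      using gdist_0[of a w] gdist_self[of a] nd(1)[OF that] that V by (auto simp: zero_ereal_def)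
    show "ndist G a w \<le> Suc (ndist G a u)" if "a \<in> Y \<union> Z" "u \<rightarrow>\<^bsub>G\<^esub> w" for a u w
    proof -
      have "u \<in> Y \<union> Z" "w \<in> Y \<union> Z" using parts[OF that(2)] by auto
      then show ?thesis using gdist_step[of a u "ndist G a u" w] nd(1) that by simp
    qed
    show "\<exists>u. w \<rightarrow>\<^bsub>G\<^esub> u \<and> ndist G a u = n" if "a \<in> Y \<union> Z" "w \<in> Y \<union> Z" "ndist G a w = Suc n" for a w n
      using gdist_pred[of a w n] nd(1)[OF that(1,2)] that(3) sym ndist_eq by metis
    show "a \<in> Y \<Longrightarrow> card {u. a \<rightarrow>\<^bsub>G\<^esub> u} = nk" for a using degY nk by simp
    show "a \<in> Z \<Longrightarrow> card {u. a \<rightarrow>\<^bsub>G\<^esub> u} = nl" for a using degZ nl by simp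
    show "card {u. w \<rightarrow>\<^bsub>G\<^esub> u \<and> ndist G a u = 1} = nY2" if "a \<in> Y" "w \<in> Y" "ndist G a w = 2" for a w
      using array_row_entry[OF bip rowY that(1), of w 1] that V nY2 by simp
    show "card {u. w \<rightarrow>\<^bsub>G\<^esub> u \<and> ndist G a u = 2} = nY3" if "a \<in> Y" "w \<in> Z" "ndist G a w = 3" for a w
      using array_row_entry[OF bip rowY that(1), of w 2] that V nY3 by simp
    show "card {u. w \<rightarrow>\<^bsub>G\<^esub> u \<and> ndist G a u = 1} = nZ2" if "a \<in> Z" "w \<in> Z" "ndist G a w = 2" for a w
      using array_row_entry[OF bip' rowZ that(1), of w 1] that V nZ2 by simp
    show "card {u. w \<rightarrow>\<^bsub>G\<^esub> u \<and> ndist G a u = 2} = nZ3" if "a \<in> Z" "w \<in> Y" "ndist G a w = 3" for a w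
      using array_row_entry[OF bip' rowZ that(1), of w 2] that V nZ3 by simp
    show "\<exists>w \<in> Y \<union> Z. ndist G a w = 4" if "a \<in> Y" for a using ex_ndist[OF bip rowY that, of 4] V by simp
    show "\<exists>w \<in> Y \<union> Z. ndist G a w = 4" if "a \<in> Z" for a using ex_ndist[OF bip' rowZ that, of 4] V by simp
  qed
  note pos = B.positive_params
  have par: "even (ndist G z w) \<longleftrightarrow> w \<notin> Y" if "w \<in> Y \<union> Z" for w
    using B.parity[OF B.zV that] z disj by auto
  have N3: "nbhd G 3 z = B.N3"
    unfolding nbhd_ndist[OF bip' rowZ z] B.N3_def V using par by force
  have N4: "nbhd G 4 z = B.N4"
    unfolding nbhd_ndist[OF bip' rowZ z] B.N4_def V using par by force
  have b2: "bZ2 = real (nl - nZ2)" and b3: "bZ3 = real (nk - nZ3)"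
    using pos nl nk nZ2 nZ3 bZ2 bZ3 by (simp_all add: of_nat_diff)
  obtain v where v: "v \<in> B.N4" using B.N4_nonempty by blast
  \<comment> \<open>Eccentricity 4 forces every neighbour of a vertex of \<open>N4\<close> back into
    \<open>N3\<close>, so the last entry is the valency.\<close>
  have "cZ4 = l"
  proof -
    have "v \<in> Z" "ndist G z v = 4" using v by (auto simp: B.N4_def)
    then have "real (card {u. v \<rightarrow>\<^bsub>G\<^esub> u \<and> ndist G z u = 3}) = cZ4"
      using array_row_entry[OF bip' rowZ z, of v 3] V by simp
    moreover have "{u. v \<rightarrow>\<^bsub>G\<^esub> u \<and> ndist G z u = 3} = {u \<in> B.N3. v \<rightarrow>\<^bsub>G\<^esub> u}"
      using B.N4_nbrs(2)[OF v] unfolding B.N3_def by blast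
    ultimately show ?thesis using B.N4_nbrs(1)[OF v] nl by simp
  qed
  \<comment> \<open>Common denominator of the hypothesis and of gamma_3. Its positivity matters
    because division by zero yields 0 in HOL.\<close>
  define D where "D = real (nk - nZ3) * (real nl - 1) + real nZ3 * (real (nl - nZ2) - 1)"
  have "real (nk - nZ3) * (real nl - 1) > 0" "real nZ3 * (real (nl - nZ2) - 1) \<ge> 0"
  proof -
    have "real (nk - nZ3) \<ge> 1" "real nl \<ge> 2" "real (nl - nZ2) \<ge> 1" using pos by linarith+
    then show "real (nk - nZ3) * (real nl - 1) > 0" "real nZ3 * (real (nl - nZ2) - 1) \<ge> 0" by simp_all
  qed
  then have D0: "D > 0" unfolding D_def by linarith
  have cY2pos: "real nY2 > 0" using pos by simp
  have D: "bZ3 * (cZ4 - 1) + cZ3 * (bZ2 - 1) = D"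
    unfolding D_def \<open>cZ4 = l\<close> b2 b3 nl nZ3 ..
  have "(bZ2 - 1) * (cZ4 - 1) = D / cY2 * (cZ2 - 1)" using eq unfolding D by linarith
  then have "(bZ2 - 1) * (cZ4 - 1) * cY2 = D * (cZ2 - 1)" using cY2pos nY2 by (simp add: field_simps)
  then have ext: "(real (nl - nZ2) - 1) * (real nl - 1) * real nY2 = D * (real nZ2 - 1)"
    unfolding \<open>cZ4 = l\<close> b2 nl nZ2 nY2 .
  have "\<gamma>3 * D = cY2 * cZ3 * (bZ2 - 1)" using gamma D0 unfolding D by simp
  then have gamD: "\<gamma>3 * D = real nY2 * real nZ3 * (real (nl - nZ2) - 1)"
    unfolding nY2 nZ3 b2 .
  have homog: "real (B.g x y) = \<gamma>3" if "x \<in> B.N3" "y \<in> B.N3" "ndist G x y = 2" for x y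
  proof -
    have "real (B.g x y) * D = \<gamma>3 * D"
      using B.homogeneous[OF ext[unfolded D_def] that] unfolding gamD unfolding D_def .
    then show ?thesis using D0 by simp
  qed
  \<comment> \<open>Two neighbours of a vertex of \<open>N4\<close>, which exist since
    \<open>l \<ge> 2\<close>. They show that gamma_3 is a natural number, namely a value of
    \<open>g\<close>.\<close>
  obtain x y where xy: "x \<in> B.N3" "y \<in> B.N3" "ndist G x y = 2"
  proof -
    obtain x where x: "x \<in> B.N3" "v \<rightarrow>\<^bsub>G\<^esub> x" using B.N4_down[OF v] by blast
    have "{y \<in> B.N3. v \<rightarrow>\<^bsub>G\<^esub> y} \<noteq> {x}" using B.N4_nbrs(1)[OF v] pos(5) by auto
    then obtain y where "y \<in> B.N3" "v \<rightarrow>\<^bsub>G\<^esub> y" "x \<noteq> y" using x by blast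
    then show ?thesis using that x B.d_2I[of x v y] sym by blast
  qed
  define gam where "gam = B.g x y"
  define del where "del = B.h x y"
  have gam: "real gam = \<gamma>3" using homog[OF xy] by (simp add: gam_def)
  have gd: "gam + del = nY2" using B.g_plus_h[OF xy] by (simp add: gam_def del_def)
  have del: "real del = cY2 - \<gamma>3" using gd gam nY2 by (simp flip: gd)
  interpret H: homogeneous_four "\<lambda>u v. u \<rightarrow>\<^bsub>G\<^esub> v" "ndist G" Y Z nk nl nY2 nY3 nZ2 nZ3 z gam del
  proof
    show "card {u \<in> B.N4. x \<rightarrow>\<^bsub>G\<^esub> u \<and> y \<rightarrow>\<^bsub>G\<^esub> u} = del" if "x \<in> B.N3" "y \<in> B.N3" "ndist G x y = 2" for x y
    proof -
      have "B.g x y = gam" using homog[OF that] gam by simp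
      then have "B.h x y = del" using B.g_plus_h[OF that] gd by simp
      then show ?thesis by (simp add: B.h_def)
    qed
    show "gam + del = nY2" by (rule gd)
    show "0 < del" using del \<open>cY2 > \<gamma>3\<close> by simp
    show "del < nk - nZ3" using del b3 \<open>bZ3 > cY2 - \<gamma>3\<close> by simp
  qed (use ext gamD gam in \<open>simp_all only: D_def\<close>)
  let ?H = "G \<restriction> (B.N3 \<union> B.N4)"
  have SV: "B.N3 \<union> B.N4 \<subseteq> verts G" using H.S_verts(1) V by blast
  have gH: "graph ?H" using SV by (rule graph_induce_subgraph)
  \<comment> \<open>Isometry: the rows of the subgraph may be computed with the distances of
    \<open>G\<close>.\<close>
  have dH: "gdist ?H a w = ereal (real (ndist G a w))" if "a \<in> B.N3 \<union> B.N4" "w \<in> B.N3 \<union> B.N4" for a w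
  proof -
    have "gdist ?H a w = gdist G a w"
    proof (rule gdist_isometric[OF SV that(1) _ _ that(2)])
      show "gdist G a w \<noteq> \<infinity>" if "w \<in> B.N3 \<union> B.N4" for w
        using nd(1)[of a w] H.S_verts(1)[OF that] H.S_verts(1)[OF \<open>a \<in> _\<close>] by simp
    next
      fix w n assume w: "w \<in> B.N3 \<union> B.N4" "gdist G a w = ereal (real (Suc n))"
      obtain u where u: "u \<in> B.N3 \<union> B.N4" "w \<rightarrow>\<^bsub>G\<^esub> u" "ndist G a u = n"
        using H.isometric[OF \<open>a \<in> B.N3 \<union> B.N4\<close> w(1) ndist_eq[OF w(2)]] by blast
      then show "\<exists>u \<in> B.N3 \<union> B.N4. u \<rightarrow>\<^bsub>G\<^esub> w \<and> gdist G a u = ereal (real n)"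
        using nd(1)[of a u] H.S_verts(1)[OF u(1)] H.S_verts(1)[OF \<open>a \<in> _\<close>] sym by blast
    qed
    then show ?thesis using nd(1)[of a w] H.S_verts(1)[OF that(1)] H.S_verts(1)[OF that(2)] by simp
  qed
  have nbrs: "{u \<in> verts ?H. w \<rightarrow>\<^bsub>?H\<^esub> u \<and> R u} = {u \<in> B.N3 \<union> B.N4. w \<rightarrow>\<^bsub>G\<^esub> u \<and> R u}"
    if "w \<in> B.N3 \<union> B.N4" for w R
    unfolding dominates_induce_subgraph induce_subgraph_verts using that by blast
  have le4: "ndist G a w \<le> 4" if "a \<in> B.N3 \<union> B.N4" "w \<in> B.N3 \<union> B.N4" for a w
    using nd(2) that H.S_verts(1) by blast
  have r3: "array_row ?H B.N3 (bZ3, [1, cY2 - \<gamma>3, cY3, bZ3])"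
  proof (rule array_rowI[OF gH, where f = "ndist G"])
    fix a assume a: "a \<in> B.N3"
    then have aS: "a \<in> B.N3 \<union> B.N4" by simp
    show "\<exists>w\<in>verts ?H. ndist G a w = length [1, cY2 - \<gamma>3, cY3, bZ3]"
      using H.S_ecc_N3[OF a] by (auto simp: eval_nat_numeral)
    show "real (card {u \<in> verts ?H. a \<rightarrow>\<^bsub>?H\<^esub> u}) = bZ3"
      using nbrs[OF aS, of "\<lambda>_. True"] H.S_degree(1)[OF a] b3 by simp
    fix w assume "w \<in> verts ?H"
    then have w: "w \<in> B.N3 \<union> B.N4" by simp
    show "gdist ?H a w = ereal (real (ndist G a w))" using dH[OF aS w] .
    show "ndist G a w \<le> length [1, cY2 - \<gamma>3, cY3, bZ3]" using le4[OF aS w] by simp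
    fix i assume i: "ndist G a w = Suc i"
    have cases: "i = 0 \<or> i = 1 \<and> w \<in> B.N3 \<or> i = 2 \<and> w \<in> B.N4 \<or> i = 3 \<and> w \<in> B.N3"
      using w H.S_dist(1)[OF a, of w] H.S_dist(3)[OF a, of w] i by auto
    have "real (card {u \<in> B.N3 \<union> B.N4. w \<rightarrow>\<^bsub>G\<^esub> u \<and> ndist G a u = i}) = [1, cY2 - \<gamma>3, cY3, bZ3] ! i"
      using cases
    proof (elim disjE conjE)
      assume "i = 0"
      then show ?thesis using H.S_c1[OF aS w] i by simp
    next
      assume "i = 1" "w \<in> B.N3"
      then show ?thesis using H.S_c2_N3[OF a, of w] i del by simp
    next
      assume "i = 2" "w \<in> B.N4"
      then show ?thesis using H.S_c3_N3[OF a, of w] i nY3 by simp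
    next
      assume "i = 3" "w \<in> B.N3"
      then show ?thesis using H.S_c4_N3[OF a, of w] i b3 by simp
    qed
    then show "real (card {u \<in> verts ?H. w \<rightarrow>\<^bsub>?H\<^esub> u \<and> ndist G a u = i}) = [1, cY2 - \<gamma>3, cY3, bZ3] ! i"
      unfolding nbrs[OF w] .
  qed
  \<comment> \<open>Path counting gives the third entry only in product form; \<open>cZ2 > 0\<close>
    allows the division.\<close>
  have q: "real n = (cY2 - \<gamma>3) * cY3 / cZ2" if "n * nZ2 = del * nY3" for n
  proof -
    have "real n * cZ2 = (cY2 - \<gamma>3) * cY3"
      using arg_cong[OF that, of real] unfolding del[symmetric] nZ2 nY3 by simp
    moreover have "cZ2 \<noteq> 0" using pos nZ2 by simp
    ultimately show ?thesis by (simp add: field_simps)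
  qed
  have r4: "array_row ?H B.N4 (l, [1, cZ2, (cY2 - \<gamma>3) * cY3 / cZ2, l])"
  proof (rule array_rowI[OF gH, where f = "ndist G"])
    fix a assume a: "a \<in> B.N4"
    then have aS: "a \<in> B.N3 \<union> B.N4" by simp
    show "\<exists>w\<in>verts ?H. ndist G a w = length [1, cZ2, (cY2 - \<gamma>3) * cY3 / cZ2, l]"
      using H.S_ecc_N4[OF a] by (auto simp: eval_nat_numeral)
    show "real (card {u \<in> verts ?H. a \<rightarrow>\<^bsub>?H\<^esub> u}) = l"
      using nbrs[OF aS, of "\<lambda>_. True"] H.S_degree(2)[OF a] nl by simp
    fix w assume "w \<in> verts ?H"
    then have w: "w \<in> B.N3 \<union> B.N4" by simp
    show "gdist ?H a w = ereal (real (ndist G a w))" using dH[OF aS w] .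
    show "ndist G a w \<le> length [1, cZ2, (cY2 - \<gamma>3) * cY3 / cZ2, l]" using le4[OF aS w] by simp
    fix i assume i: "ndist G a w = Suc i"
    have cases: "i = 0 \<or> i = 1 \<and> w \<in> B.N4 \<or> i = 2 \<and> w \<in> B.N3 \<or> i = 3 \<and> w \<in> B.N4"
      using w H.S_dist(4)[OF a, of w] H.S_dist(2)[OF a, of w] i by auto
    have "real (card {u \<in> B.N3 \<union> B.N4. w \<rightarrow>\<^bsub>G\<^esub> u \<and> ndist G a u = i})
        = [1, cZ2, (cY2 - \<gamma>3) * cY3 / cZ2, l] ! i"
      using cases
    proof (elim disjE conjE)
      assume "i = 0"
      then show ?thesis using H.S_c1[OF aS w] i by simp
    next
      assume "i = 1" "w \<in> B.N4"
      then show ?thesis using H.S_c2_N4[OF a, of w] i nZ2 by simp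
    next
      assume "i = 2" "w \<in> B.N3"
      then show ?thesis using q[OF H.S_c3_N4[OF a, of w]] i by simp
    next
      assume "i = 3" "w \<in> B.N4"
      then show ?thesis using H.S_c4_N4[OF a, of w] i nl by simp
    qed
    then show "real (card {u \<in> verts ?H. w \<rightarrow>\<^bsub>?H\<^esub> u \<and> ndist G a u = i})
        = [1, cZ2, (cY2 - \<gamma>3) * cY3 / cZ2, l] ! i"
      unfolding nbrs[OF w] .
  qed
  have bH: "bipartite_graph ?H B.N3 B.N4"
    unfolding bipartite_graph_def
  proof (intro conjI allI impI)
    show "graph ?H" by (rule gH)
    show "verts ?H = B.N3 \<union> B.N4" by simp
    show "B.N3 \<inter> B.N4 = {}" by (auto simp: B.N3_def B.N4_def)
    fix u w assume "u \<rightarrow>\<^bsub>?H\<^esub> w"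
    then have "u \<in> B.N3 \<union> B.N4" "w \<in> B.N3 \<union> B.N4" "u \<rightarrow>\<^bsub>G\<^esub> w" by (auto simp: dominates_induce_subgraph)
    then show "u \<in> B.N3 \<and> w \<in> B.N4 \<or> u \<in> B.N4 \<and> w \<in> B.N3" using H.adj_S by blast
  qed
  show "nbhd G 3 z \<subseteq> Y \<and> nbhd G 4 z \<subseteq> Z \<and>
    distance_biregular (G \<restriction> (nbhd G 3 z \<union> nbhd G 4 z)) (nbhd G 3 z) (nbhd G 4 z) \<and>
    intersection_array (G \<restriction> (nbhd G 3 z \<union> nbhd G 4 z)) (nbhd G 3 z) (nbhd G 4 z)
      (bZ3, [1, cY2 - \<gamma>3, cY3, bZ3])
      (l, [1, cZ2, (cY2 - \<gamma>3) * cY3 / cZ2, l])"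
    unfolding N3 N4 intersection_array_def
    using r3 r4 distance_biregular_of_array_rows[OF bH r3 r4] by (auto simp: B.N3_def B.N4_def)
qed

end
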